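(* Let $m$ and $n$ be natural numbers (positive integers), and let $\mathbb{C}^{m\times(n,m,m)}$ denote the space of all $m\times(n,m,m)$ triples. (a) If $m<n(1+\sqrt5)/2$, then there is exactly one $m\times(n,m,m)$ triple of the form $\mathcal{L}^{(l)}(F_{pq},0_p,0_p)$ (with integers $l\ge 0$ and $0\le p\le q$). All triples that are feedback similar to it form an open and everywhere dense set in $\mathbb{C}^{m\times(n,m,m)}$, and this set coincides with the set of all $m\times(n,m,m)$ triples that are rigid with respect to feedback similarity. (b) If $m>n(1+\sqrt5)/2$, then no $m\times(n,m,m)$ triple is rigid with respect to feedback similarity.
   Context: An $m\times(n,m,m)$ triple is a triple $(C,B,A)$ of complex matrices with $C\in\mathbb{C}^{m\times n}$, $B,A\in\mathbb{C}^{m\times m}$; the set of such triples is identified with $\mathbb{C}^{m(n+2m)}$ with its usual topology. Two such triples $(C,B,A)$ and $(C',B',A')$ are feedback similar if $[C'\ B'\ A']=S^{-1}[C\ B\ A]\begin{bmatrix}P&V&U\\0&S&0\\0&0&S\end{bmatrix}$ for some matrices $U,V\in\mathbb{C}^{n\times m}$ and nonsingular $P\in\mathbb{C}^{n\times n}$, $S\in\mathbb{C}^{m\times m}$. A triple $\mathcal{T}$ is rigid with respect to feedback similarity if there is a neighborhood of $\mathcal{T}$ in $\mathbb{C}^{m\times(n,m,m)}$ all of whose elements are feedback similar to $\mathcal{T}$. $0_{ab}$ denotes the $a\times b$ zero matrix, $0_a:=0_{aa}$; matrices with zero rows or zero columns are allowed (there is exactly one $0\times b$ and one $a\times 0$ matrix,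 regarded as zero matrices). For $0\le r\le l$, $F_{rl}:=[I_r\ \ 0_{r,l-r}]$. For a $p\times(q,p,p)$ triple $(C,B,A)$, $\mathcal{L}(C,B,A)$ is the $(2p+q)\times(p+q,2p+q,2p+q)$ triple $\left(\begin{bmatrix}I_{p+q}\\0_{p,p+q}\end{bmatrix},\ \begin{bmatrix}0_{p+q,q}&0_{p+q,p}&0_{p+q,p}\\0_{pq}&I_p&0_p\end{bmatrix},\ \begin{bmatrix}0_{p+q,q+2p}\\ C\ \ B\ \ A\end{bmatrix}\right)$, and $\mathcal{L}^{(i)}$ denotes the $i$-fold iterate of $\mathcal{L}$ ($\mathcal{L}^{(0)}$ is the identity). *)

theory Defs
  imports Complex_Main "Jordan_Normal_Form.Matrix"
begin

type_synonym ctriple = "complex mat \<times> complex mat \<times> complex mat"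

definition is_triple :: "nat \<Rightarrow> nat \<Rightarrow> ctriple \<Rightarrow> bool" where
  "is_triple m n T = (case T of (C,B,A) \<Rightarrow>
     C \<in> carrier_mat m n \<and> B \<in> carrier_mat m m \<and> A \<in> carrier_mat m m)"

text \<open>Feedback similarity: [C' B' A'] = S^-1 [C B A] [[P,V,U],[0,S,0],[0,0,S]],
  with the block product written out: C' = S^-1 C P, B' = S^-1 (C V + B S),
  A' = S^-1 (C U + A S).\<close>
definition feedback_similar :: "nat \<Rightarrow> nat \<Rightarrow> ctriple \<Rightarrow> ctriple \<Rightarrow> bool" where
  "feedback_similar m n T T' = (case T of (C,B,A) \<Rightarrow> case T' of (C',B',A') \<Rightarrow>
     (\<exists>U V P S Sinv.
        U \<in> carrier_mat n m \<and> V \<in> carrier_mat n m \<and>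
        P \<in> carrier_mat n n \<and> invertible_mat P \<and>
        S \<in> carrier_mat m m \<and> Sinv \<in> carrier_mat m m \<and>
        S * Sinv = 1\<^sub>m m \<and> Sinv * S = 1\<^sub>m m \<and>
        C' = Sinv * (C * P) \<and>
        B' = Sinv * (C * V + B * S) \<and>
        A' = Sinv * (C * U + A * S)))"

definition triple_close :: "real \<Rightarrow> ctriple \<Rightarrow> ctriple \<Rightarrow> bool" where
  "triple_close e T T' = (case T of (C,B,A) \<Rightarrow> case T' of (C',B',A') \<Rightarrow>
     (\<forall>i<dim_row C. \<forall>j<dim_col C. cmod (C $$ (i,j) - C' $$ (i,j)) < e) \<and>
     (\<forall>i<dim_row B. \<forall>j<dim_col B. cmod (B $$ (i,j) - B' $$ (i,j)) < e) \<and>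
     (\<forall>i<dim_row A. \<forall>j<dim_col A. cmod (A $$ (i,j) - A' $$ (i,j)) < e))"

definition triples_open :: "nat \<Rightarrow> nat \<Rightarrow> ctriple set \<Rightarrow> bool" where
  "triples_open m n X = (X \<subseteq> {T. is_triple m n T} \<and>
     (\<forall>T\<in>X. \<exists>e>0. \<forall>T'. is_triple m n T' \<and> triple_close e T T' \<longrightarrow> T' \<in> X))"

definition triples_dense :: "nat \<Rightarrow> nat \<Rightarrow> ctriple set \<Rightarrow> bool" where
  "triples_dense m n X = (X \<subseteq> {T. is_triple m n T} \<and>
     (\<forall>T. is_triple m n T \<longrightarrow> (\<forall>e>0. \<exists>T'\<in>X. triple_close e T T')))"

definition rigid :: "nat \<Rightarrow> nat \<Rightarrow> ctriple \<Rightarrow> bool" where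
  "rigid m n T = (is_triple m n T \<and>
     (\<exists>e>0. \<forall>T'. is_triple m n T' \<and> triple_close e T T' \<longrightarrow> feedback_similar m n T T'))"

definition Fmat :: "nat \<Rightarrow> nat \<Rightarrow> complex mat" where
  "Fmat r l = mat r l (\<lambda>(i,j). if i = j then 1 else 0)"

definition Lop :: "ctriple \<Rightarrow> ctriple" where
  "Lop T = (case T of (C,B,A) \<Rightarrow>
     let p = dim_row C; q = dim_col C; N = 2*p + q in
     (mat N (p+q) (\<lambda>(i,j). if i < p+q \<and> i = j then 1 else 0),
      mat N N (\<lambda>(i,j). if p+q \<le> i \<and> j = i - (p+q) + q then 1 else 0),
      mat N N (\<lambda>(i,j). if p+q \<le> i then
                          (if j < q then C $$ (i-(p+q), j)
                           else if j < q+p then B $$ (i-(p+q), j-q)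
                           else A $$ (i-(p+q), j-(q+p)))
                        else 0)))"

definition canonical_form :: "ctriple \<Rightarrow> bool" where
  "canonical_form T = (\<exists>l p q. p \<le> q \<and>
     T = (Lop ^^ l) (Fmat p q, 0\<^sub>m p p, 0\<^sub>m p p))"

end

theory Submission
  imports Defs "Jordan_Normal_Form.Determinant" "Jordan_Normal_Form.Char_Poly"
begin

text \<open>
  If \<open>n < m < 2 n\<close>, put \<open>p = m - n\<close> and \<open>q = 2 n - m\<close>. A generic \<open>m \<times> (n,m,m)\<close> triple can be
  normalised by feedback similarity to \<open>\<L>(C,B,A)\<close> for a \<open>p \<times> (q,p,p)\<close> triple \<open>(C,B,A)\<close>, by
  transformations that depend continuously on the triple and equal the identity on the image of \<open>\<L>\<close>.
  Since \<open>\<L>\<close> preserves similarity, an open dense orbit of \<open>p \<times> (q,p,p)\<close> triples is carried to an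
  open dense orbit of \<open>m \<times> (n,m,m)\<close> triples. The form \<open>m\<^sup>2 - m n - n\<^sup>2\<close> is invariant under
  \<open>(m,n) \<mapsto> (p,q)\<close>, so as long as it is negative the descent ends in the case \<open>m \<le> n\<close>, where a
  generic triple is similar to \<open>(F,0,0)\<close>.

  If that form is positive, the group has fewer parameters than the space has coordinates. Suppose an
  orbit contained a ball, take in it a grid with \<open>D + 1\<close> values per coordinate, and write each grid
  point as a rational function of bounded degree of its group parameters. After clearing denominators the
  Lagrange polynomials of the grid pull back to a space of polynomials whose dimension, for large \<open>D\<close>,
  is smaller than the number of grid points; but they are linearly independent.
\<close>

subsection \<open>Matrix algebra and feedback similarity\<close>

lemma mult_assoc_dim:
  fixes A B C :: "'a::semiring_0 mat"
  assumes "dim_col A = dim_row B" "dim_col B = dim_row C"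
  shows "(A * B) * C = A * (B * C)"
  using assms by (intro assoc_mult_mat[of A "dim_row A" "dim_col A" B "dim_col B" C "dim_col C"]) auto

lemma mult_add_dim:
  fixes A B C :: "'a::semiring_0 mat"
  assumes "dim_col A = dim_row B" "dim_row B = dim_row C" "dim_col B = dim_col C"
  shows "A * (B + C) = A * B + A * C"
  using assms by (intro mult_add_distrib_mat[of A "dim_row A" "dim_col A" B "dim_col B" C]) auto

lemma add_mult_dim:
  fixes A B C :: "'a::semiring_0 mat"
  assumes "dim_col A = dim_row C" "dim_row A = dim_row B" "dim_col A = dim_col B"
  shows "(A + B) * C = A * C + B * C"
  using assms by (intro add_mult_distrib_mat[of A "dim_row A" "dim_col A" B C "dim_col C"]) auto

lemma add_assoc_dim:
  fixes A B C :: "'a::semiring_0 mat"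
  assumes "dim_row A = dim_row B" "dim_col A = dim_col B" "dim_row B = dim_row C" "dim_col B = dim_col C"
  shows "(A + B) + C = A + (B + C)"
  using assms by (intro eq_matI) (auto simp: add.assoc)

lemma add_uminus_dim:
  fixes A :: "'a::ring mat"
  shows "A + - A = 0\<^sub>m (dim_row A) (dim_col A)" "- A + A = 0\<^sub>m (dim_row A) (dim_col A)"
  by (intro eq_matI; auto)+

lemma add_cancel_dim:
  fixes A B :: "'a::ring mat"
  assumes "dim_row A = dim_row B" "dim_col A = dim_col B"
  shows "A + (- A + B) = B" "- A + (A + B) = B"
  using assms by (intro eq_matI; auto)+

lemma zero_mult_dim:
  fixes A :: "'a::semiring_0 mat"
  shows "dim_row A = k \<Longrightarrow> 0\<^sub>m r k * A = 0\<^sub>m r (dim_col A)"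
    "dim_col A = k \<Longrightarrow> A * 0\<^sub>m k c = 0\<^sub>m (dim_row A) c"
    "dim_row A = r \<Longrightarrow> dim_col A = k \<Longrightarrow> 0\<^sub>m r k + A = A"
    "dim_row A = r \<Longrightarrow> dim_col A = k \<Longrightarrow> A + 0\<^sub>m r k = A"
  by (auto intro!: eq_matI)

lemma one_mult_dim:
  fixes A :: "'a::semiring_1 mat"
  shows "dim_row A = k \<Longrightarrow> 1\<^sub>m k * A = A" "dim_col A = k \<Longrightarrow> A * 1\<^sub>m k = A"
  by (auto intro!: eq_matI)

text \<open>Rewrites to sums of right-nested products. The side conditions are equations between
  dimensions instead of \<open>carrier_mat\<close> facts, so that the simplifier can settle
  them.\<close>

lemmas mat_norm = mult_assoc_dim mult_add_dim add_mult_dim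
  add_assoc_dim add_uminus_dim add_cancel_dim zero_mult_dim one_mult_dim

text \<open>In a right-nested product the left-hand side of \<open>A * B = E\<close> is no longer a
  subterm; this form rewrites it in front of a remaining factor \<open>X\<close>.\<close>

lemma left_cancel_dim:
  fixes A B :: "'a::semiring_0 mat"
  assumes "A * B = E" "dim_col A = dim_row B" "dim_col B = dim_row X"
  shows "A * (B * X) = E * X"
  using assms mult_assoc_dim by metis

lemma invertible_matI:
  fixes P :: "'a::semiring_1 mat"
  assumes "P \<in> carrier_mat n n" "Q \<in> carrier_mat n n" "P * Q = 1\<^sub>m n" "Q * P = 1\<^sub>m n"
  shows "invertible_mat P"
  using assms unfolding invertible_mat_def inverts_mat_def by auto

lemma invertible_matE:
  fixes P :: "'a::semiring_1 mat"
  assumes "invertible_mat P" "P \<in> carrier_mat n n"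
  obtains Q where "Q \<in> carrier_mat n n" "P * Q = 1\<^sub>m n" "Q * P = 1\<^sub>m n"
proof -
  from assms obtain Q where Q: "P * Q = 1\<^sub>m n" "Q * P = 1\<^sub>m (dim_row Q)"
    unfolding invertible_mat_def inverts_mat_def by auto
  have "dim_col Q = n" using arg_cong[OF Q(1), of dim_col] by simp
  moreover have "dim_row Q = n" using arg_cong[OF Q(2), of dim_col] assms(2) by simp
  ultimately show thesis using Q that by auto
qed

section \<open>The feedback group and its action on triples\<close>

definition act :: "complex mat \<Rightarrow> complex mat \<Rightarrow> complex mat \<Rightarrow> complex mat \<Rightarrow> complex mat \<Rightarrow> ctriple \<Rightarrow> ctriple" where
  "act P V U S S' = (\<lambda>(C,B,A). (S' * (C * P), S' * (C * V + B * S), S' * (C * U + A * S)))"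

text \<open>\<open>S'\<close> is carried along as the inverse of \<open>S\<close> because it enters
  the action; the inverse of \<open>P\<close> does not, so for \<open>P\<close> invertibility is
  stated by a predicate.\<close>

definition gelt :: "nat \<Rightarrow> nat \<Rightarrow> complex mat \<Rightarrow> complex mat \<Rightarrow> complex mat \<Rightarrow> complex mat \<Rightarrow> complex mat \<Rightarrow> bool" where
  "gelt m n P V U S S' \<longleftrightarrow> P \<in> carrier_mat n n \<and> invertible_mat P \<and> V \<in> carrier_mat n m \<and> U \<in> carrier_mat n m
     \<and> S \<in> carrier_mat m m \<and> S' \<in> carrier_mat m m \<and> S * S' = 1\<^sub>m m \<and> S' * S = 1\<^sub>m m"

lemma feedback_similar_act:
  "feedback_similar m n T T' \<longleftrightarrow> (\<exists>P V U S S'. gelt m n P V U S S' \<and> T' = act P V U S S' T)"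
  unfolding feedback_similar_def gelt_def act_def by (cases T; cases T') (auto; metis)

lemma is_triple_act: "gelt m n P V U S S' \<Longrightarrow> is_triple m n T \<Longrightarrow> is_triple m n (act P V U S S' T)"
  unfolding gelt_def act_def is_triple_def by auto

lemma is_triple_feedback: "feedback_similar m n T T' \<Longrightarrow> is_triple m n T \<Longrightarrow> is_triple m n T'"
  using is_triple_act feedback_similar_act by metis

text \<open>Group elements are the block matrices \<open>[P V U; 0 S 0; 0 0 S]\<close>, which are
  closed under products; the witnesses are the blocks of the product.\<close>

lemma feedback_trans:
  assumes T: "is_triple m n T" and 1: "feedback_similar m n T T1" and 2: "feedback_similar m n T1 T2"
  shows "feedback_similar m n T T2"
proof -
  obtain P V U S S' where g: "gelt m n P V U S S'" "T1 = act P V U S S' T"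
    using 1 feedback_similar_act by metis
  obtain P2 V2 U2 S2 S2' where h: "gelt m n P2 V2 U2 S2 S2'" "T2 = act P2 V2 U2 S2 S2' T1"
    using 2 feedback_similar_act by metis
  obtain Q where Q: "Q \<in> carrier_mat n n" "P * Q = 1\<^sub>m n" "Q * P = 1\<^sub>m n"
    using g invertible_matE[of P n] unfolding gelt_def by metis
  obtain Q2 where Q2: "Q2 \<in> carrier_mat n n" "P2 * Q2 = 1\<^sub>m n" "Q2 * P2 = 1\<^sub>m n"
    using h invertible_matE[of P2 n] unfolding gelt_def by metis
  have d: "dim_row P = n" "dim_col P = n" "dim_row Q = n" "dim_col Q = n" "dim_row P2 = n" "dim_col P2 = n"
    "dim_row Q2 = n" "dim_col Q2 = n" "dim_row S = m" "dim_col S = m" "dim_row S' = m" "dim_col S' = m"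
    "dim_row S2 = m" "dim_col S2 = m" "dim_row S2' = m" "dim_col S2' = m"
    "dim_row V = n" "dim_col V = m" "dim_row U = n" "dim_col U = m"
    "dim_row V2 = n" "dim_col V2 = m" "dim_row U2 = n" "dim_col U2 = m"
    using g h Q Q2 unfolding gelt_def by auto
  have SS: "S * S' = 1\<^sub>m m" "S' * S = 1\<^sub>m m" "S2 * S2' = 1\<^sub>m m" "S2' * S2 = 1\<^sub>m m"
    using g h unfolding gelt_def by auto
  have "gelt m n (P * P2) (P * V2 + V * S2) (P * U2 + U * S2) (S * S2) (S2' * S')"
    unfolding gelt_def
    using d by (auto intro!: invertible_matI[of "P * P2" n "Q2 * Q"]
        simp: mat_norm Q Q2 SS left_cancel_dim[OF Q(2)] left_cancel_dim[OF Q2(2)]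
        left_cancel_dim[OF Q(3)] left_cancel_dim[OF Q2(3)] SS[THEN left_cancel_dim])
  moreover have "T2 = act (P * P2) (P * V2 + V * S2) (P * U2 + U * S2) (S * S2) (S2' * S') T"
    unfolding h(2) g(2) act_def using T d
    by (auto simp: is_triple_def mat_norm SS SS[THEN left_cancel_dim])
  ultimately show ?thesis unfolding feedback_similar_act by blast
qed

text \<open>The inverse of \<open>[P V U; 0 S 0; 0 0 S]\<close> has first block row
  \<open>[Q, - Q V S', - Q U S']\<close>, where \<open>Q\<close> is the inverse of
  \<open>P\<close>.\<close>

lemma feedback_sym:
  assumes T: "is_triple m n T" and 1: "feedback_similar m n T T1"
  shows "feedback_similar m n T1 T"
proof -
  obtain P V U S S' where g: "gelt m n P V U S S'" "T1 = act P V U S S' T"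
    using 1 feedback_similar_act by metis
  obtain Q where Q: "Q \<in> carrier_mat n n" "P * Q = 1\<^sub>m n" "Q * P = 1\<^sub>m n"
    using g invertible_matE[of P n] unfolding gelt_def by metis
  have d: "dim_row P = n" "dim_col P = n" "dim_row Q = n" "dim_col Q = n"
    "dim_row S = m" "dim_col S = m" "dim_row S' = m" "dim_col S' = m"
    "dim_row V = n" "dim_col V = m" "dim_row U = n" "dim_col U = m"
    using g Q unfolding gelt_def by auto
  have SS: "S * S' = 1\<^sub>m m" "S' * S = 1\<^sub>m m"
    using g unfolding gelt_def by auto
  have "gelt m n Q (- (Q * V * S')) (- (Q * U * S')) S' S"
    unfolding gelt_def
    using d by (auto intro!: invertible_matI[of Q n P] simp: mat_norm Q SS)
  moreover have "T = act Q (- (Q * V * S')) (- (Q * U * S')) S' S T1"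
    unfolding g(2) act_def using T d
    by (auto simp: is_triple_def mat_norm SS Q SS[THEN left_cancel_dim] Q(2,3)[THEN left_cancel_dim])
  ultimately show ?thesis unfolding feedback_similar_act by blast
qed

subsection \<open>The reduction step\<close>

lemma feedback_actI: "gelt m n P V U S S' \<Longrightarrow> feedback_similar m n T (act P V U S S' T)"
  unfolding feedback_similar_act by blast

section \<open>Selection matrices\<close>

definition sel :: "nat \<Rightarrow> nat \<Rightarrow> nat \<Rightarrow> complex mat" where
  "sel r c a = mat r c (\<lambda>(i,j). if j = i + a then 1 else 0)"

text \<open>The transpose of \<open>sel\<close>: where \<open>sel r c a\<close> reads off the
  coordinates a, ..., a+r-1, \<open>tsel c r a\<close> embeds into them.\<close>

definition tsel :: "nat \<Rightarrow> nat \<Rightarrow> nat \<Rightarrow> complex mat" where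
  "tsel c r a = mat c r (\<lambda>(i,j). if i = j + a then 1 else 0)"

lemma sel_dim [simp]: "dim_row (sel r c a) = r" "dim_col (sel r c a) = c"
  "dim_row (tsel c r a) = c" "dim_col (tsel c r a) = r"
  by (auto simp: sel_def tsel_def)

lemma sel_mult:
  assumes "a + r \<le> c" "dim_row M = c"
  shows "sel r c a * M = mat r (dim_col M) (\<lambda>(i,j). M $$ (i + a, j))"
proof (rule eq_matI)
  fix i j assume "i < dim_row (mat r (dim_col M) (\<lambda>(i,j). M $$ (i + a, j)))"
    "j < dim_col (mat r (dim_col M) (\<lambda>(i,j). M $$ (i + a, j)))"
  then have ij: "i < r" "j < dim_col M" by auto
  have "(sel r c a * M) $$ (i,j) = (\<Sum>k<c. (if k = i + a then 1 else 0) * M $$ (k,j))"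
    using ij assms by (simp add: sel_def scalar_prod_def lessThan_atLeast0)
  also have "\<dots> = (\<Sum>k<c. if k = i + a then M $$ (k,j) else 0)" by (intro sum.cong) auto
  also have "\<dots> = M $$ (i + a, j)" using ij assms by simp
  finally show "(sel r c a * M) $$ (i,j) = mat r (dim_col M) (\<lambda>(i,j). M $$ (i + a, j)) $$ (i,j)"
    using ij by simp
qed (auto simp: assms)

lemma tsel_mult:
  assumes "dim_row M = r"
  shows "tsel c r a * M = mat c (dim_col M) (\<lambda>(i,j). if a \<le> i \<and> i < a + r then M $$ (i - a, j) else 0)"
    (is "_ = ?R")
proof (rule eq_matI)
  fix i j assume "i < dim_row ?R" "j < dim_col ?R"
  then have ij: "i < c" "j < dim_col M" by auto
  have "(tsel c r a * M) $$ (i,j) = (\<Sum>k<r. (if i = k + a then 1 else 0) * M $$ (k,j))"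
    using ij assms by (simp add: tsel_def scalar_prod_def lessThan_atLeast0)
  also have "\<dots> = (\<Sum>k<r. if a \<le> i \<and> k = i - a then M $$ (k,j) else 0)" by (intro sum.cong) auto
  also have "\<dots> = (if a \<le> i \<and> i < a + r then M $$ (i - a, j) else 0)"
  proof (cases "a \<le> i")
    case True
    then show ?thesis by (auto simp: sum.delta)
  qed auto
  finally show "(tsel c r a * M) $$ (i,j) = ?R $$ (i,j)"
    using ij by simp
qed (auto simp: assms)

lemma mult_sel:
  assumes "dim_col M = r"
  shows "M * sel r c a = mat (dim_row M) c (\<lambda>(i,j). if a \<le> j \<and> j < a + r then M $$ (i, j - a) else 0)"
    (is "_ = ?R")
proof (rule eq_matI)
  fix i j assume "i < dim_row ?R" "j < dim_col ?R"
  then have ij: "i < dim_row M" "j < c" by auto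
  have "(M * sel r c a) $$ (i,j) = (\<Sum>k<r. M $$ (i,k) * (if j = k + a then 1 else 0))"
    using ij assms by (simp add: sel_def scalar_prod_def lessThan_atLeast0)
  also have "\<dots> = (\<Sum>k<r. if a \<le> j \<and> k = j - a then M $$ (i,k) else 0)" by (intro sum.cong) auto
  also have "\<dots> = (if a \<le> j \<and> j < a + r then M $$ (i, j - a) else 0)"
  proof (cases "a \<le> j")
    case True
    then show ?thesis by (auto simp: sum.delta)
  qed auto
  finally show "(M * sel r c a) $$ (i,j) = ?R $$ (i,j)"
    using ij by simp
qed (auto simp: assms)

lemma sel_tsel_same: "a + r \<le> c \<Longrightarrow> sel r c a * tsel c r a = 1\<^sub>m r"
  by (subst sel_mult) (auto simp: tsel_def)

lemma sel_tsel_disjoint: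
  "a + r \<le> c \<Longrightarrow> b + s \<le> c \<Longrightarrow> a + r \<le> b \<or> b + s \<le> a \<Longrightarrow> sel r c a * tsel c s b = 0\<^sub>m r s"
  by (subst sel_mult) (auto simp: tsel_def)

lemma tsel_sel: "tsel c r a * sel r c a = mat c c (\<lambda>(i,j). if a \<le> i \<and> i < a + r \<and> i = j then 1 else 0)"
  by (subst tsel_mult) (auto simp: sel_def intro!: eq_matI)

lemma uminus_zero_mat: "- 0\<^sub>m r c = (0\<^sub>m r c :: 'a::ring mat)"
  by (intro eq_matI) auto

lemma add_commute_dim:
  fixes A B :: "'a::comm_monoid_add mat"
  assumes "dim_row A = dim_row B" "dim_col A = dim_col B"
  shows "A + B = B + A"
  using assms by (intro eq_matI) (auto simp: add.commute)

lemma add_left_commute_dim: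
  fixes A B C :: "'a::comm_monoid_add mat"
  assumes "dim_row A = dim_row B" "dim_col A = dim_col B" "dim_row B = dim_row C" "dim_col B = dim_col C"
  shows "A + (B + C) = B + (A + C)"
  using assms by (intro eq_matI) (auto simp: add.left_commute)

lemma add_eq_imp_uminus_dim:
  fixes A B C :: "'a::ring mat"
  assumes "A + B = C" "dim_row A = dim_row B" "dim_col A = dim_col B"
  shows "- A + C = B"
  using assms by (auto simp: mat_norm)

section \<open>Normalising triples to the image of the operator\<close>

locale reduction =
  fixes p q n m :: nat
  assumes n_eq: "n = p + q" and m_eq: "m = n + p"
begin

definition "C0 = tsel m n 0"
definition "\<rho> = sel n m 0"
definition "\<iota> = tsel m p n"
definition "\<pi> = sel p m n"
definition "\<epsilon>i = tsel m q 0"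
definition "\<epsilon>p = sel q m 0"
definition "\<tau> = tsel m p q"
definition "\<sigma> = sel p m q"

text \<open>
  The matrices that cut \<open>\<complex>\<^sup>m\<close> into blocks of sizes \<open>n, p\<close> (\<open>\<rho>\<close>, \<open>\<pi>\<close> project, \<open>C0\<close>, \<open>\<iota>\<close> embed) and of
  sizes \<open>q, p, p\<close> (\<open>\<epsilon>p\<close>, \<open>\<sigma>\<close>, \<open>\<pi>\<close> project, \<open>\<epsilon>i\<close>, \<open>\<tau>\<close>, \<open>\<iota>\<close> embed).
\<close>
lemmas block_defs = C0_def \<rho>_def \<iota>_def \<pi>_def \<epsilon>i_def \<epsilon>p_def \<tau>_def \<sigma>_def

lemma block_dim [simp]:
  "dim_row C0 = m" "dim_col C0 = n" "dim_row \<rho> = n" "dim_col \<rho> = m"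
  "dim_row \<iota> = m" "dim_col \<iota> = p" "dim_row \<pi> = p" "dim_col \<pi> = m"
  "dim_row \<epsilon>i = m" "dim_col \<epsilon>i = q" "dim_row \<epsilon>p = q" "dim_col \<epsilon>p = m"
  "dim_row \<tau> = m" "dim_col \<tau> = p" "dim_row \<sigma> = p" "dim_col \<sigma> = m"
  by (auto simp: block_defs)

lemma block_id:
  "\<rho> * C0 = 1\<^sub>m n" "\<rho> * \<iota> = 0\<^sub>m n p" "\<pi> * C0 = 0\<^sub>m p n" "\<pi> * \<iota> = 1\<^sub>m p"
  "\<epsilon>p * \<epsilon>i = 1\<^sub>m q" "\<epsilon>p * \<tau> = 0\<^sub>m q p" "\<epsilon>p * \<iota> = 0\<^sub>m q p"
  "\<sigma> * \<epsilon>i = 0\<^sub>m p q" "\<sigma> * \<tau> = 1\<^sub>m p" "\<sigma> * \<iota> = 0\<^sub>m p p"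
  "\<pi> * \<epsilon>i = 0\<^sub>m p q" "\<pi> * \<tau> = 0\<^sub>m p p"
  unfolding block_defs using n_eq m_eq by (simp_all add: sel_tsel_same sel_tsel_disjoint)

lemmas block_id_left = block_id[THEN left_cancel_dim]

lemma block_sum: "C0 * \<rho> + \<iota> * \<pi> = 1\<^sub>m m" "\<epsilon>i * \<epsilon>p + (\<tau> * \<sigma> + \<iota> * \<pi>) = 1\<^sub>m m"
  unfolding block_defs using n_eq m_eq by (auto simp: tsel_sel intro!: eq_matI)

lemma block_split:
  assumes "dim_row X = m" shows "C0 * (\<rho> * X) + \<iota> * (\<pi> * X) = X"
proof -
  have "(C0 * \<rho> + \<iota> * \<pi>) * X = X" using assms by (simp add: block_sum mat_norm)
  then show ?thesis using assms by (simp add: mat_norm)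
qed

lemma block_split3:
  assumes "dim_row X = m" shows "\<epsilon>i * (\<epsilon>p * X) + (\<tau> * (\<sigma> * X) + \<iota> * (\<pi> * X)) = X"
proof -
  have "(\<epsilon>i * \<epsilon>p + (\<tau> * \<sigma> + \<iota> * \<pi>)) * X = X" using assms by (simp add: block_sum mat_norm)
  then show ?thesis using assms by (simp add: mat_norm)
qed

text \<open>The triples reached by \<open>feedback_C0\<close> and \<open>feedback_K\<close>:
  \<open>C\<close> is \<open>C0\<close>, and \<open>B\<close>, \<open>A\<close> vanish outside their
  last p rows, which are \<open>B2\<close> and \<open>A2\<close>.\<close>

definition "K B2 A2 = (C0, \<iota> * B2, \<iota> * A2)"
text \<open>
  \<open>SC C\<close> has first block column \<open>C\<close>, hence its inverse carries \<open>C\<close> to \<open>C0\<close>; \<open>W B2\<close> has block row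
  \<open>B2\<close> in the place of \<open>\<sigma>\<close>, hence its inverse carries \<open>B2\<close> to \<open>\<sigma>\<close>.
\<close>
definition "SC C = C * \<rho> + \<iota> * \<pi>"
definition "W B2 = \<epsilon>i * \<epsilon>p + (\<tau> * B2 + \<iota> * \<pi>)"
text \<open>\<open>cat\<close> is the block row [C B A] of a p x (q,p,p) triple, of width q + 2p =
  m, and \<open>uncat\<close> cuts such a row into its blocks again.\<close>

definition "cat = (\<lambda>(C,B,A). C * \<epsilon>p + (B * \<sigma> + A * \<pi>))"
definition "uncat M = (M * \<epsilon>i, M * \<tau>, M * \<iota>)"

lemma SC_C0: "SC C0 = 1\<^sub>m m" unfolding SC_def by (rule block_sum)
lemma W_\<sigma>: "W \<sigma> = 1\<^sub>m m" unfolding W_def by (rule block_sum)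

lemma is_triple_K: "B2 \<in> carrier_mat p m \<Longrightarrow> A2 \<in> carrier_mat p m \<Longrightarrow> is_triple m n (K B2 A2)"
  unfolding K_def is_triple_def by (auto intro!: carrier_matI)

lemma cat_carrier: "is_triple p q Y \<Longrightarrow> cat Y \<in> carrier_mat p m"
  unfolding cat_def is_triple_def by (auto intro!: carrier_matI)

lemma is_triple_uncat: "M \<in> carrier_mat p m \<Longrightarrow> is_triple p q (uncat M)"
  unfolding uncat_def is_triple_def by (auto intro!: carrier_matI)

lemma cat_uncat:
  assumes "M \<in> carrier_mat p m" shows "cat (uncat M) = M"
proof -
  have "M * (\<epsilon>i * \<epsilon>p + (\<tau> * \<sigma> + \<iota> * \<pi>)) = M" using assms by (simp add: block_sum mat_norm)
  then show ?thesis using assms by (simp add: mat_norm cat_def uncat_def)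
qed

lemma uncat_cat:
  assumes "is_triple p q Y" shows "uncat (cat Y) = Y"
  using assms unfolding cat_def uncat_def is_triple_def
  by (auto simp: mat_norm block_id)

text \<open>The nonzero block row of the second matrix is [0 I 0], which is \<open>\<sigma>\<close>,
  and that of the third is [C B A], which is \<open>cat Y\<close>. All three matrices are compared
  entry by entry.\<close>

lemma Lop_eq_K:
  assumes "is_triple p q Y" shows "Lop Y = K \<sigma> (cat Y)"
proof -
  obtain C B A where Y: "Y = (C,B,A)" by (cases Y) auto
  then have c: "C \<in> carrier_mat p q" "B \<in> carrier_mat p p" "A \<in> carrier_mat p p"
    using assms unfolding is_triple_def by auto
  have mm: "m = 2 * p + q" "n = p + q" using n_eq m_eq by auto
  have cat: "cat Y = mat p m (\<lambda>(i,j). if j < q then C $$ (i,j) else if j < q + p then B $$ (i, j - q) else A $$ (i, j - (q + p)))"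
    using c unfolding cat_def Y \<epsilon>p_def \<sigma>_def \<pi>_def
    by (auto simp: mult_sel mm add.commute intro!: eq_matI)
  have 3: "\<iota> * cat Y = mat m m (\<lambda>(i,j). if p+q \<le> i then
                          (if j < q then C $$ (i-(p+q), j)
                           else if j < q+p then B $$ (i-(p+q), j-q)
                           else A $$ (i-(p+q), j-(q+p)))
                        else 0)"
    unfolding cat \<iota>_def by (subst tsel_mult) (auto simp: mm intro!: eq_matI)
  have 2: "\<iota> * \<sigma> = mat m m (\<lambda>(i,j). if p+q \<le> i \<and> j = i - (p+q) + q then 1 else 0)"
    unfolding \<sigma>_def \<iota>_def by (subst tsel_mult) (auto simp: mm sel_def intro!: eq_matI)
  have 1: "C0 = mat m n (\<lambda>(i,j). if i < p+q \<and> i = j then 1 else 0)"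
    unfolding C0_def tsel_def by (auto simp: mm intro!: eq_matI)
  have d: "2 * dim_row C + dim_col C = m" "dim_row C + dim_col C = n" "dim_row C = p" "dim_col C = q"
    using c mm by auto
  show ?thesis unfolding K_def 1 2 3
    unfolding Lop_def Y Let_def prod.case d using mm by simp
qed

text \<open>Adding \<open>C0 * V\<close> changes the first n rows of \<open>B\<close> arbitrarily
  and leaves the others alone, so these rows can be cancelled; likewise for
  \<open>A\<close>.\<close>

lemma feedback_K:
  assumes "B \<in> carrier_mat m m" "A \<in> carrier_mat m m"
  shows "feedback_similar m n (C0, B, A) (K (\<pi> * B) (\<pi> * A))"
  unfolding feedback_similar_act
proof (intro exI conjI)
  show "gelt m n (1\<^sub>m n) (- (\<rho> * B)) (- (\<rho> * A)) (1\<^sub>m m) (1\<^sub>m m)"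
    using assms unfolding gelt_def by (auto intro!: invertible_matI[of "1\<^sub>m n" n "1\<^sub>m n"] carrier_matI)
  show "K (\<pi> * B) (\<pi> * A) = act (1\<^sub>m n) (- (\<rho> * B)) (- (\<rho> * A)) (1\<^sub>m m) (1\<^sub>m m) (C0, B, A)"
    unfolding K_def act_def
    using assms by (simp add: mat_norm add_eq_imp_uminus_dim[OF block_split])
qed

lemma feedback_C0:
  assumes C: "C \<in> carrier_mat m n" and BA: "B \<in> carrier_mat m m" "A \<in> carrier_mat m m"
    and V: "V \<in> carrier_mat m m" "SC C * V = 1\<^sub>m m" "V * SC C = 1\<^sub>m m"
  shows "feedback_similar m n (C, B, A) (C0, V * (B * SC C), V * (A * SC C))"
  unfolding feedback_similar_act
proof (intro exI conjI)
  show "gelt m n (1\<^sub>m n) (0\<^sub>m n m) (0\<^sub>m n m) (SC C) V"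
    using assms unfolding gelt_def
    by (auto intro!: invertible_matI[of "1\<^sub>m n" n "1\<^sub>m n"] carrier_matI simp: SC_def)
  have d: "dim_row (SC C) = m" "dim_col (SC C) = m" unfolding SC_def using C by auto
  have "SC C * C0 = C" unfolding SC_def using C by (simp add: mat_norm block_id)
  then have "V * C = V * SC C * C0" using C V d by (metis block_dim(1) carrier_matD(2) mult_assoc_dim)
  then have "V * C = C0" unfolding V(3) by (simp add: mat_norm)
  then show "(C0, V * (B * SC C), V * (A * SC C)) = act (1\<^sub>m n) (0\<^sub>m n m) (0\<^sub>m n m) (SC C) V (C, B, A)"
    unfolding act_def using C BA V by (simp add: mat_norm SC_def)
qed

text \<open>The hypothesis on \<open>\<pi> * S\<close> says that the last p rows of \<open>S\<close>
  are [0 Y]. Thus \<open>S\<close> maps the range of \<open>C0\<close> to itself, and a suitable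
  \<open>P\<close> restores \<open>C0\<close>. What the change of basis creates in the first n rows
  of \<open>B\<close> and \<open>A\<close> is removed by \<open>feedback_K\<close>.\<close>

lemma feedback_K_K:
  assumes B2: "B2 \<in> carrier_mat p m" and A2: "A2 \<in> carrier_mat p m"
    and S: "S \<in> carrier_mat m m" "S' \<in> carrier_mat m m" "S * S' = 1\<^sub>m m" "S' * S = 1\<^sub>m m"
    and Y: "Y \<in> carrier_mat p p" "Y' \<in> carrier_mat p p" "Y * Y' = 1\<^sub>m p" "Y' * Y = 1\<^sub>m p"
    and SY: "\<pi> * S = Y * \<pi>"
  shows "feedback_similar m n (K B2 A2) (K (Y' * (B2 * S)) (Y' * (A2 * S)))"
proof -
  have d: "dim_row S = m" "dim_col S = m" "dim_row S' = m" "dim_col S' = m" "dim_row Y = p" "dim_col Y = p"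
    "dim_row Y' = p" "dim_col Y' = p" "dim_row B2 = p" "dim_col B2 = m" "dim_row A2 = p" "dim_col A2 = m"
    using B2 A2 S(1,2) Y(1,2) by auto
  note SS = S(3,4) Y(3,4) S(3,4)[THEN left_cancel_dim] Y(3,4)[THEN left_cancel_dim]
  have "Y' * (\<pi> * S) * S' = Y' * (Y * \<pi>) * S'" using SY by simp
  then have SY': "\<pi> * S' = Y' * \<pi>" using d by (simp add: mat_norm SS)
  have "\<pi> * (S * C0) = 0\<^sub>m p n" "\<pi> * (S' * C0) = 0\<^sub>m p n"
    using d by (simp_all add: left_cancel_dim[OF SY] left_cancel_dim[OF SY'] mult_assoc_dim block_id zero_mult_dim)
  \<comment> \<open>The columns of \<open>S * C0\<close> lie in the range of \<open>C0\<close>, so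
    \<open>P = \<rho> * (S * C0)\<close> satisfies \<open>C0 * P = S * C0\<close>.\<close>
  then have 1: "C0 * (\<rho> * (S * C0)) = S * C0" and 2: "C0 * (\<rho> * (S' * C0)) = S' * C0"
    using block_split[of "S * C0"] block_split[of "S' * C0"] d by (simp_all add: zero_mult_dim)
  have g: "gelt m n (\<rho> * (S * C0)) (0\<^sub>m n m) (0\<^sub>m n m) S S'"
    unfolding gelt_def
  proof (intro conjI S)
    show "\<rho> * (S * C0) \<in> carrier_mat n n" by (rule carrier_matI) simp_all
    show "invertible_mat (\<rho> * (S * C0))"
      using d by (intro invertible_matI[of _ n "\<rho> * (S' * C0)"] carrier_matI)
        (simp_all add: mat_norm 1 2 SS block_id)
  qed auto
  define T where "T = act (\<rho> * (S * C0)) (0\<^sub>m n m) (0\<^sub>m n m) S S' (K B2 A2)"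
  have T: "T = (C0, S' * (\<iota> * (B2 * S)), S' * (\<iota> * (A2 * S)))"
    unfolding T_def act_def K_def using d by (simp add: mat_norm 1 SS)
  have f: "feedback_similar m n (K B2 A2) T" unfolding T_def by (rule feedback_actI[OF g])
  have "feedback_similar m n T (K (\<pi> * (S' * (\<iota> * (B2 * S)))) (\<pi> * (S' * (\<iota> * (A2 * S)))))"
    unfolding T by (rule feedback_K) (simp_all add: carrier_matI d)
  also have "K (\<pi> * (S' * (\<iota> * (B2 * S)))) (\<pi> * (S' * (\<iota> * (A2 * S)))) = K (Y' * (B2 * S)) (Y' * (A2 * S))"
    using d by (simp add: left_cancel_dim[OF SY'] mat_norm block_id_left)
  finally show ?thesis by (rule feedback_trans[OF is_triple_K[OF B2 A2] f])
qed

text \<open>The last p rows of \<open>W B2\<close>, hence of \<open>V\<close>, are [0 I], so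
  \<open>feedback_K_K\<close> applies with \<open>S = V\<close> and the identity for
  \<open>Y\<close>. Since \<open>\<sigma> * W B2 = B2\<close>, the row \<open>B2\<close> becomes
  \<open>\<sigma>\<close>.\<close>

lemma feedback_W:
  assumes B2: "B2 \<in> carrier_mat p m" and A2: "A2 \<in> carrier_mat p m"
    and V: "V \<in> carrier_mat m m" "W B2 * V = 1\<^sub>m m" "V * W B2 = 1\<^sub>m m"
  shows "feedback_similar m n (K B2 A2) (K \<sigma> (A2 * V))"
proof -
  have d: "dim_row B2 = p" "dim_col B2 = m" "dim_row A2 = p" "dim_col A2 = m" "dim_row V = m" "dim_col V = m"
     "dim_row (W B2) = m" "dim_col (W B2) = m"
    using assms by (auto simp: W_def)
  have 1: "\<pi> * W B2 = \<pi>" unfolding W_def using d by (simp add: mat_norm block_id block_id_left)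
  have 2: "\<sigma> * W B2 = B2" unfolding W_def using d by (simp add: mat_norm block_id block_id_left)
  have 3: "\<pi> * V = 1\<^sub>m p * \<pi>"
    using left_cancel_dim[OF 1, of V] d V(2) by (simp add: one_mult_dim)
  have 4: "B2 * V = \<sigma>"
    using left_cancel_dim[OF 2, of V] d V(2) by (simp add: one_mult_dim)
  have "feedback_similar m n (K B2 A2) (K (1\<^sub>m p * (B2 * V)) (1\<^sub>m p * (A2 * V)))"
    by (rule feedback_K_K[OF B2 A2 V(1) _ V(3,2) _ _ _ _ 3]) (simp_all add: carrier_matI d)
  then show ?thesis using 4 d by (simp add: mat_norm)
qed

text \<open>One level up, the block matrix of the given similarity serves as change of basis. It
  turns \<open>\<sigma>\<close> into \<open>S * \<sigma>\<close>, which \<open>S'\<close> undoes,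
  and together with \<open>S'\<close> it turns \<open>cat Y\<close> into \<open>cat Y'\<close> by
  the very formula that defines similarity.\<close>

lemma feedback_Lop:
  assumes Y: "is_triple p q Y" and f: "feedback_similar p q Y Y'"
  shows "feedback_similar m n (Lop Y) (Lop Y')"
proof -
  obtain P V U S S' where g: "gelt p q P V U S S'" "Y' = act P V U S S' Y"
    using f feedback_similar_act by metis
  obtain Q where Q: "Q \<in> carrier_mat q q" "P * Q = 1\<^sub>m q" "Q * P = 1\<^sub>m q"
    using g invertible_matE[of P q] unfolding gelt_def by metis
  have d: "dim_row P = q" "dim_col P = q" "dim_row Q = q" "dim_col Q = q"
    "dim_row S = p" "dim_col S = p" "dim_row S' = p" "dim_col S' = p"
    "dim_row V = q" "dim_col V = p" "dim_row U = q" "dim_col U = p"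
    using g Q unfolding gelt_def by auto
  have SS0: "S * S' = 1\<^sub>m p" "S' * S = 1\<^sub>m p"
    using g unfolding gelt_def by auto
  note SS = SS0 Q(2,3) SS0[THEN left_cancel_dim] Q(2,3)[THEN left_cancel_dim]
  \<comment> \<open>\<open>R\<close> is the block matrix \<open>[P V U; 0 S 0; 0 0 S]\<close> of the definition of feedback similarity; it
    plays the role of \<open>S\<close> one level up.\<close>
  define R where "R = \<epsilon>i * (P * \<epsilon>p + (V * \<sigma> + U * \<pi>)) + (\<tau> * (S * \<sigma>) + \<iota> * (S * \<pi>))"
  define R' where "R' = \<epsilon>i * (Q * \<epsilon>p + (- (Q * (V * (S' * \<sigma>))) + - (Q * (U * (S' * \<pi>))))) + (\<tau> * (S' * \<sigma>) + \<iota> * (S' * \<pi>))"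
  have dR: "R \<in> carrier_mat m m" "R' \<in> carrier_mat m m" unfolding R_def R'_def by (auto intro!: carrier_matI)
  have ER: "\<epsilon>p * R = P * \<epsilon>p + (V * \<sigma> + U * \<pi>)" "\<sigma> * R = S * \<sigma>" "\<pi> * R = S * \<pi>"
    unfolding R_def using d by (simp_all add: mat_norm block_id block_id_left)
  have ER': "\<epsilon>p * R' = Q * \<epsilon>p + (- (Q * (V * (S' * \<sigma>))) + - (Q * (U * (S' * \<pi>))))" "\<sigma> * R' = S' * \<sigma>" "\<pi> * R' = S' * \<pi>"
    unfolding R'_def using d by (simp_all add: mat_norm uminus_zero_mat block_id block_id_left)
  \<comment> \<open>A matrix is determined by its three block rows, so being the identity can be
    checked on these.\<close>
  have E: "X = 1\<^sub>m m" if "X \<in> carrier_mat m m" "\<epsilon>p * X = \<epsilon>p" "\<sigma> * X = \<sigma>" "\<pi> * X = \<pi>" for X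
    using block_split3[of X] that block_sum by simp
  have RR: "R * R' = 1\<^sub>m m"
  proof (rule E)
    show "\<epsilon>p * (R * R') = \<epsilon>p" "\<sigma> * (R * R') = \<sigma>" "\<pi> * (R * R') = \<pi>" using d dR
      by (simp_all add: ER[THEN left_cancel_dim] mat_norm uminus_zero_mat ER' ER SS)
         (intro eq_matI; simp)
  qed (use dR in auto)
  have RR': "R' * R = 1\<^sub>m m"
  proof (rule E)
    show "\<epsilon>p * (R' * R) = \<epsilon>p" "\<sigma> * (R' * R) = \<sigma>" "\<pi> * (R' * R) = \<pi>" using d dR
      by (simp_all add: ER'[THEN left_cancel_dim] mat_norm uminus_zero_mat ER' ER SS)
         (intro eq_matI; simp)
  qed (use dR in auto)
  obtain C B A where YC: "Y = (C,B,A)" by (cases Y) auto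
  have dC: "dim_row C = p" "dim_col C = q" "dim_row B = p" "dim_col B = p" "dim_row A = p" "dim_col A = p"
    using Y unfolding YC is_triple_def by auto
  have dRd: "dim_row R = m" "dim_col R = m" using dR by auto
  have cY: "cat Y \<in> carrier_mat p m" using cat_carrier Y .
  have Y': "is_triple p q Y'" using Y f is_triple_feedback by blast
  have "feedback_similar m n (K \<sigma> (cat Y)) (K (S' * (\<sigma> * R)) (S' * (cat Y * R)))"
    by (rule feedback_K_K[OF _ cY dR RR RR' _ _ SS0 ER(3)]) (simp_all add: carrier_matI d)
  also have "S' * (\<sigma> * R) = \<sigma>" using d by (simp add: ER SS)
  also have "S' * (cat Y * R) = cat Y'"
    unfolding g(2) YC cat_def act_def using d dC
    by (simp add: mat_norm ER add_commute_dim add_left_commute_dim dRd)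
  finally show ?thesis using Lop_eq_K[OF Y] Lop_eq_K[OF Y'] by simp
qed

end

subsection \<open>Limits of matrices and triples\<close>

text \<open>Convergence is taken along sequences, entry by entry: sums, products and determinants
  then go through by limit rules, without estimates. The carrier conditions keep all dimensions
  fixed.\<close>

definition mconv :: "nat \<Rightarrow> nat \<Rightarrow> (nat \<Rightarrow> complex mat) \<Rightarrow> complex mat \<Rightarrow> bool" where
  "mconv r c X L \<longleftrightarrow> (\<forall>k. X k \<in> carrier_mat r c) \<and> L \<in> carrier_mat r c \<and>
     (\<forall>i<r. \<forall>j<c. (\<lambda>k. X k $$ (i,j)) \<longlonglongrightarrow> L $$ (i,j))"

lemma mconv_const: "A \<in> carrier_mat r c \<Longrightarrow> mconv r c (\<lambda>k. A) A"
  by (auto simp: mconv_def)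

lemma mconvI:
  assumes "\<And>k. X k \<in> carrier_mat r c" "L \<in> carrier_mat r c"
    "\<And>i j. i < r \<Longrightarrow> j < c \<Longrightarrow> (\<lambda>k. X k $$ (i,j)) \<longlonglongrightarrow> L $$ (i,j)"
  shows "mconv r c X L"
  using assms unfolding mconv_def by blast

lemma mconvD:
  assumes "mconv r c X L"
  shows "X k \<in> carrier_mat r c" "L \<in> carrier_mat r c"
    "dim_row (X k) = r" "dim_col (X k) = c" "dim_row L = r" "dim_col L = c"
    "i < r \<Longrightarrow> j < c \<Longrightarrow> (\<lambda>k. X k $$ (i,j)) \<longlonglongrightarrow> L $$ (i,j)"
  using assms unfolding mconv_def by auto

lemma mconv_add:
  assumes "mconv r c X L" "mconv r c Y M"
  shows "mconv r c (\<lambda>k. X k + Y k) (L + M)"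
proof (rule mconvI)
  fix i j assume ij: "i < r" "j < c"
  have "(\<lambda>k. X k $$ (i,j) + Y k $$ (i,j)) \<longlonglongrightarrow> L $$ (i,j) + M $$ (i,j)"
    using ij by (intro tendsto_add mconvD(7)[OF assms(1)] mconvD(7)[OF assms(2)])
  then show "(\<lambda>k. (X k + Y k) $$ (i,j)) \<longlonglongrightarrow> (L + M) $$ (i,j)"
    using ij by (simp add: mconvD(3-6)[OF assms(2)])
qed (simp_all add: mconvD(2) mconvD(1) assms carrier_matI mconvD(3-6)[OF assms(2)])

lemma mconv_mult:
  assumes X: "mconv r s X L" and Y: "mconv s c Y M"
  shows "mconv r c (\<lambda>k. X k * Y k) (L * M)"
proof -
  have X': "\<And>k. X k \<in> carrier_mat r s" "L \<in> carrier_mat r s"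
    "\<And>i j. i < r \<Longrightarrow> j < s \<Longrightarrow> (\<lambda>k. X k $$ (i,j)) \<longlonglongrightarrow> L $$ (i,j)" using X unfolding mconv_def by auto
  have Y': "\<And>k. Y k \<in> carrier_mat s c" "M \<in> carrier_mat s c"
    "\<And>i j. i < s \<Longrightarrow> j < c \<Longrightarrow> (\<lambda>k. Y k $$ (i,j)) \<longlonglongrightarrow> M $$ (i,j)" using Y unfolding mconv_def by auto
  have e: "(A * B) $$ (i,j) = (\<Sum>l<s. A $$ (i,l) * B $$ (l,j))"
    if "A \<in> carrier_mat r s" "B \<in> carrier_mat s c" "i < r" "j < c" for A B :: "complex mat" and i j
    using that by (auto simp: scalar_prod_def lessThan_atLeast0 intro!: sum.cong)
  show ?thesis unfolding mconv_def
  proof (intro conjI allI impI)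
    fix i j assume ij: "i < r" "j < c"
    have "(\<lambda>k. \<Sum>l<s. X k $$ (i,l) * Y k $$ (l,j)) \<longlonglongrightarrow> (\<Sum>l<s. L $$ (i,l) * M $$ (l,j))"
      using ij by (intro tendsto_sum tendsto_mult X' Y') auto
    then show "(\<lambda>k. (X k * Y k) $$ (i,j)) \<longlonglongrightarrow> (L * M) $$ (i,j)"
      using e[OF X'(1) Y'(1) ij] e[OF X'(2) Y'(2) ij] by simp
  qed (use mult_carrier_mat[OF X'(1) Y'(1)] mult_carrier_mat[OF X'(2) Y'(2)] in auto)
qed

text \<open>By the Leibniz formula the determinant is a polynomial in the entries.\<close>

lemma mconv_det:
  assumes X: "mconv n n X L" shows "(\<lambda>k. det (X k)) \<longlonglongrightarrow> det L"
proof -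
  have d: "det A = (\<Sum>p | p permutes {0..<n}. signof p * (\<Prod>i = 0..<n. A $$ (i, p i)))"
    if "A \<in> carrier_mat n n" for A :: "complex mat" by (rule det_def'[OF that])
  have "(\<lambda>k. \<Sum>p | p permutes {0..<n}. signof p * (\<Prod>i = 0..<n. X k $$ (i, p i)))
    \<longlonglongrightarrow> (\<Sum>p | p permutes {0..<n}. signof p * (\<Prod>i = 0..<n. L $$ (i, p i)))"
  proof (intro tendsto_sum tendsto_mult tendsto_prod tendsto_const)
    fix p i assume p: "p \<in> {p. p permutes {0..<n}}" and i: "i \<in> {0..<n}"
    then have "p i < n" using permutes_in_image[of p "{0..<n}" i] by auto
    then show "(\<lambda>k. X k $$ (i, p i)) \<longlonglongrightarrow> L $$ (i, p i)" using X i unfolding mconv_def by auto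
  qed
  then show ?thesis using X d unfolding mconv_def by simp
qed

lemma mconv_smult:
  assumes "a \<longlonglongrightarrow> b" "mconv r c X L"
  shows "mconv r c (\<lambda>k. a k \<cdot>\<^sub>m X k) (b \<cdot>\<^sub>m L)"
proof (rule mconvI)
  fix i j assume ij: "i < r" "j < c"
  have "(\<lambda>k. a k * X k $$ (i,j)) \<longlonglongrightarrow> b * L $$ (i,j)"
    using ij by (intro tendsto_mult assms(1) mconvD(7)[OF assms(2)])
  then show "(\<lambda>k. (a k \<cdot>\<^sub>m X k) $$ (i,j)) \<longlonglongrightarrow> (b \<cdot>\<^sub>m L) $$ (i,j)"
    using ij by (simp add: mconvD(3-6)[OF assms(2)])
qed (simp_all add: carrier_matI mconvD(3-6)[OF assms(2)])

lemma mconv_mat: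
  assumes "\<And>i j. i < r \<Longrightarrow> j < c \<Longrightarrow> (\<lambda>k. f k (i,j)) \<longlonglongrightarrow> g (i,j)"
  shows "mconv r c (\<lambda>k. mat r c (f k)) (mat r c g)"
  by (rule mconvI) (auto simp: assms)

lemma mconv_adj:
  assumes X: "mconv n n X L" shows "mconv n n (\<lambda>k. adj_mat (X k)) (adj_mat L)"
  unfolding adj_mat_def mconvD[OF X]
proof (intro mconv_mat, unfold prod.case)
  fix i j assume ij: "i < n" "j < n"
  show "(\<lambda>k. cofactor (X k) j i) \<longlonglongrightarrow> cofactor L j i"
    unfolding cofactor_def
  proof (intro tendsto_mult tendsto_const mconv_det)
    show "mconv (n - 1) (n - 1) (\<lambda>k. mat_delete (X k) j i) (mat_delete L j i)"
      unfolding mat_delete_def mconvD[OF X] using ij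
      by (intro mconv_mat) (auto intro!: mconvD(7)[OF X])
  qed
qed

lemma one_smult: "(1 :: 'a::semiring_1) \<cdot>\<^sub>m A = A"
  by (intro eq_matI) auto

lemma inverse_adj:
  fixes M :: "complex mat"
  assumes "M \<in> carrier_mat n n" "det M \<noteq> 0"
  shows "M * (inverse (det M) \<cdot>\<^sub>m adj_mat M) = 1\<^sub>m n" "inverse (det M) \<cdot>\<^sub>m adj_mat M * M = 1\<^sub>m n"
  using adj_mat[OF assms(1)] assms
  by (simp_all add: mult_smult_distrib[of _ n n _ n] mult_smult_assoc_mat[of _ n n _ n])
    (auto intro!: eq_matI)

lemma det_nonzero_inverse:
  fixes M :: "complex mat"
  assumes "M \<in> carrier_mat n n" "det M \<noteq> 0"
  obtains V where "V \<in> carrier_mat n n" "M * V = 1\<^sub>m n" "V * M = 1\<^sub>m n"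
  using inverse_adj[OF assms] adj_mat(1)[OF assms(1)] that by (metis smult_carrier_mat)

text \<open>The sequence is \<open>inverse (det (X k)) \<cdot>\<^sub>m adj_mat (X k)\<close>. As
  \<open>inverse 0 = 0\<close>, it has the right size for every k; it is an inverse as soon as the
  determinant, which tends to 1, is nonzero.\<close>

lemma mconv_inverse_one:
  assumes X: "mconv n n X (1\<^sub>m n)"
  obtains V where "mconv n n V (1\<^sub>m n)" "\<forall>\<^sub>F k in sequentially. X k * V k = 1\<^sub>m n \<and> V k * X k = 1\<^sub>m n"
proof
  have adj1: "adj_mat (1\<^sub>m n) = (1\<^sub>m n :: complex mat)"
    using adj_mat[of "1\<^sub>m n :: complex mat" n] by (auto simp: mat_norm)
  have d: "(\<lambda>k. det (X k)) \<longlonglongrightarrow> 1" using mconv_det[OF X] by simp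
  have "mconv n n (\<lambda>k. inverse (det (X k)) \<cdot>\<^sub>m adj_mat (X k)) (inverse 1 \<cdot>\<^sub>m adj_mat (1\<^sub>m n))"
    by (intro mconv_smult mconv_adj X tendsto_inverse d) auto
  then show "mconv n n (\<lambda>k. inverse (det (X k)) \<cdot>\<^sub>m adj_mat (X k)) (1\<^sub>m n)" unfolding adj1 by (simp add: one_smult)
  have "\<forall>\<^sub>F k in sequentially. det (X k) \<noteq> 0"
    using tendsto_imp_eventually_ne[OF d] by auto
  then show "\<forall>\<^sub>F k in sequentially. X k * (inverse (det (X k)) \<cdot>\<^sub>m adj_mat (X k)) = 1\<^sub>m n \<and>
    inverse (det (X k)) \<cdot>\<^sub>m adj_mat (X k) * X k = 1\<^sub>m n"
    by eventually_elim (use inverse_adj X in \<open>auto simp: mconv_def\<close>)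
qed

section \<open>Segments of matrices and perturbation to invertible ones\<close>

definition aff :: "complex \<Rightarrow> complex mat \<Rightarrow> complex mat \<Rightarrow> complex mat" where
  "aff t A B = (1 - t) \<cdot>\<^sub>m A + t \<cdot>\<^sub>m B"

lemma aff_dim [simp]: "dim_row (aff t A B) = dim_row B" "dim_col (aff t A B) = dim_col B"
  by (auto simp: aff_def)

lemma smult_mult_dim:
  fixes A B :: "'a::comm_semiring_0 mat"
  assumes "dim_col A = dim_row B"
  shows "(k \<cdot>\<^sub>m A) * B = k \<cdot>\<^sub>m (A * B)" "A * (k \<cdot>\<^sub>m B) = k \<cdot>\<^sub>m (A * B)"
  using assms by (auto intro!: eq_matI)

lemma aff_mult:
  assumes "dim_row A = dim_row B" "dim_col A = dim_col B" "dim_col B = dim_row C"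
  shows "aff t A B * C = aff t (A * C) (B * C)"
  unfolding aff_def using assms
  by (simp add: add_mult_dim smult_mult_dim)

lemma mult_aff:
  assumes "dim_row A = dim_row B" "dim_col A = dim_col B" "dim_row B = dim_col C"
  shows "C * aff t A B = aff t (C * A) (C * B)"
  unfolding aff_def using assms
  by (simp add: mult_add_dim smult_mult_dim)

lemma aff_add:
  assumes "dim_row A = dim_row B" "dim_col A = dim_col B" "dim_row B = dim_row C" "dim_col B = dim_col C"
  shows "aff t A B + C = aff t (A + C) (B + C)" "C + aff t A B = aff t (C + A) (C + B)"
  unfolding aff_def using assms by (auto intro!: eq_matI simp: algebra_simps)

lemma mconv_aff:
  assumes "t \<longlonglongrightarrow> 0" "A \<in> carrier_mat r c" "B \<in> carrier_mat r c"
  shows "mconv r c (\<lambda>k. aff (t k) A B) A"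
proof -
  have "(\<lambda>k. 1 - t k) \<longlonglongrightarrow> 1" using tendsto_diff[OF tendsto_const assms(1), of 1] by simp
  then have "mconv r c (\<lambda>k. aff (t k) A B) (1 \<cdot>\<^sub>m A + 0 \<cdot>\<^sub>m B)"
    unfolding aff_def using assms by (intro mconv_add mconv_smult mconv_const)
  also have "1 \<cdot>\<^sub>m A + 0 \<cdot>\<^sub>m B = A" using assms by (auto intro!: eq_matI)
  finally show ?thesis .
qed

text \<open>With s = t / (1 - t), the point on the segment from \<open>M\<close> to the identity I
  is (M + s I) / (1 + s). It is singular only if s is a root of the characteristic polynomial of
  \<open>- M\<close>, and a sequence tending to 0 can avoid the finitely many roots.\<close>

lemma aff_one_invertible:
  fixes M :: "complex mat"
  assumes M: "M \<in> carrier_mat n n"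
  obtains t :: "nat \<Rightarrow> complex" where "t \<longlonglongrightarrow> 0" "\<And>k. det (aff (t k) M (1\<^sub>m n)) \<noteq> 0"
proof -
  define p where "p = char_poly (- M)"
  have "p \<noteq> 0" unfolding p_def using degree_monic_char_poly[of "- M" n] M by auto
  then have fin: "finite {z. poly p z = 0}" by (rule poly_roots_finite)
  define f :: "nat \<Rightarrow> complex" where "f k = 1 / of_nat (Suc k)" for k
  have inj: "inj f" unfolding f_def by (rule injI) (simp del: of_nat_Suc)
  have "finite (f -` {z. poly p z = 0})" by (rule finite_vimageI[OF fin inj])
  then obtain N where "\<forall>k \<in> f -` {z. poly p z = 0}. k < N"
    unfolding finite_nat_set_iff_bounded by blast
  then have N: "poly p (f k) \<noteq> 0" if "k \<ge> N" for k using that by force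
  \<comment> \<open>The shift by \<open>N\<close> skips every index at which \<open>f\<close> hits a
    root.\<close>
  define s where "s k = f (k + N)" for k
  define t where "t k = s k / (1 + s k)" for k
  have f0: "f \<longlonglongrightarrow> 0" unfolding f_def using LIMSEQ_Suc[OF lim_1_over_n[where 'a=complex]] by simp
  then have s0: "s \<longlonglongrightarrow> 0" unfolding s_def by (rule LIMSEQ_ignore_initial_segment)
  have ne: "1 + s k \<noteq> 0" for k
  proof -
    have "1 + s k = complex_of_real (1 + 1 / real (Suc (k + N)))" unfolding s_def f_def by simp
    moreover have "1 + 1 / real (Suc (k + N)) > 0" by (simp add: add_pos_pos)
    ultimately show ?thesis by (metis less_irrefl of_real_eq_0_iff)
  qed
  have "(\<lambda>k. s k / (1 + s k)) \<longlonglongrightarrow> 0 / (1 + 0)"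
    by (intro tendsto_intros s0) auto
  then have "t \<longlonglongrightarrow> 0" unfolding t_def by simp
  moreover have "det (aff (t k) M (1\<^sub>m n)) \<noteq> 0" for k
  proof -
    have "aff (t k) M (1\<^sub>m n) = inverse (1 + s k) \<cdot>\<^sub>m (M + s k \<cdot>\<^sub>m 1\<^sub>m n)"
    proof -
      have e: "1 - t k = inverse (1 + s k)" "t k = inverse (1 + s k) * s k"
        unfolding t_def using ne[of k] by (auto simp: field_simps)
      show ?thesis unfolding aff_def e(1) unfolding e(2) using M by (auto intro!: eq_matI simp: algebra_simps)
    qed
    moreover have "det (M + s k \<cdot>\<^sub>m 1\<^sub>m n) \<noteq> 0"
    proof -
      have "poly p (s k) = det (- (char_matrix (- M) (s k)))"
        unfolding p_def using M by (intro char_poly_matrix[of _ n]) auto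
      also have "- (char_matrix (- M) (s k)) = M + s k \<cdot>\<^sub>m 1\<^sub>m n"
        unfolding char_matrix_def using M by (auto intro!: eq_matI)
      finally show ?thesis using N[of "k + N"] unfolding s_def by simp
    qed
    ultimately show ?thesis using ne[of k] by (simp add: det_smult)
  qed
  ultimately show thesis using that by blast
qed

section \<open>Limits of triples\<close>

definition tconv :: "nat \<Rightarrow> nat \<Rightarrow> (nat \<Rightarrow> ctriple) \<Rightarrow> ctriple \<Rightarrow> bool" where
  "tconv m n X T \<longleftrightarrow> mconv m n (\<lambda>k. fst (X k)) (fst T) \<and> mconv m m (\<lambda>k. fst (snd (X k))) (fst (snd T))
     \<and> mconv m m (\<lambda>k. snd (snd (X k))) (snd (snd T))"

lemma tconv_triple: "tconv m n (\<lambda>k. (C k, B k, A k)) (C', B', A') \<longleftrightarrow>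
   mconv m n C C' \<and> mconv m m B B' \<and> mconv m m A A'"
  by (simp add: tconv_def)

lemma tconv_is_triple: "tconv m n X T \<Longrightarrow> is_triple m n (X k)" "tconv m n X T \<Longrightarrow> is_triple m n T"
  unfolding tconv_def is_triple_def split_beta by (blast dest: mconvD(1,2))+

lemma tconv_act:
  assumes g: "gelt m n P V U S S'" and X: "tconv m n X T"
  shows "tconv m n (\<lambda>k. act P V U S S' (X k)) (act P V U S S' T)"
proof -
  have c: "P \<in> carrier_mat n n" "V \<in> carrier_mat n m" "U \<in> carrier_mat n m" "S \<in> carrier_mat m m" "S' \<in> carrier_mat m m"
    using g unfolding gelt_def by auto
  show ?thesis using X unfolding tconv_def act_def
    by (auto simp: split_beta intro!: mconv_mult mconv_add mconv_const c)
qed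

lemma mconv_eventually_close:
  assumes "mconv r c X L" "e > 0"
  shows "\<forall>\<^sub>F k in sequentially. \<forall>i<dim_row L. \<forall>j<dim_col L. cmod (L $$ (i,j) - X k $$ (i,j)) < e"
proof -
  have c: "dim_row L = r" "dim_col L = c" using assms unfolding mconv_def by auto
  have "\<forall>\<^sub>F k in sequentially. \<forall>i\<in>{..<r}. \<forall>j\<in>{..<c}. cmod (L $$ (i,j) - X k $$ (i,j)) < e"
  proof (intro eventually_ball_finite finite_lessThan ballI)
    fix i j assume "i \<in> {..<r}" "j \<in> {..<c}"
    then have "(\<lambda>k. X k $$ (i,j)) \<longlonglongrightarrow> L $$ (i,j)" using assms unfolding mconv_def by auto
    then show "\<forall>\<^sub>F k in sequentially. cmod (L $$ (i,j) - X k $$ (i,j)) < e"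
      using assms(2) by (auto dest!: tendstoD[of _ _ _ e] simp: dist_norm norm_minus_commute)
  qed
  then show ?thesis unfolding c by (simp add: Ball_def)
qed

lemma tconv_eventually_close:
  assumes "tconv m n X T" "e > 0" shows "\<forall>\<^sub>F k in sequentially. triple_close e T (X k)"
proof -
  have "\<forall>\<^sub>F k in sequentially. (\<forall>i<dim_row (fst T). \<forall>j<dim_col (fst T). cmod (fst T $$ (i,j) - fst (X k) $$ (i,j)) < e) \<and>
    (\<forall>i<dim_row (fst (snd T)). \<forall>j<dim_col (fst (snd T)). cmod (fst (snd T) $$ (i,j) - fst (snd (X k)) $$ (i,j)) < e) \<and>
    (\<forall>i<dim_row (snd (snd T)). \<forall>j<dim_col (snd (snd T)). cmod (snd (snd T) $$ (i,j) - snd (snd (X k)) $$ (i,j)) < e)"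
    using assms unfolding tconv_def by (intro eventually_conj mconv_eventually_close) auto
  then show ?thesis by (simp add: triple_close_def split_beta)
qed

lemma mconvI_inverse_Suc:
  assumes "\<And>k. X k \<in> carrier_mat r c" "L \<in> carrier_mat r c"
    "\<And>k i j. i < r \<Longrightarrow> j < c \<Longrightarrow> cmod (L $$ (i,j) - X k $$ (i,j)) < inverse (real (Suc k))"
  shows "mconv r c X L"
  unfolding mconv_def
proof (intro conjI allI impI)
  fix i j assume ij: "i < r" "j < c"
  have "(\<lambda>k. X k $$ (i,j) - L $$ (i,j)) \<longlonglongrightarrow> 0"
  proof (rule tendsto_norm_zero_cancel, rule tendsto_sandwich[OF _ _ tendsto_const LIMSEQ_inverse_real_of_nat])
    show "\<forall>\<^sub>F k in sequentially. cmod (X k $$ (i,j) - L $$ (i,j)) \<le> inverse (real (Suc k))"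
      using assms(3)[OF ij] by (intro always_eventually allI less_imp_le) (subst norm_minus_commute)
  qed auto
  then show "(\<lambda>k. X k $$ (i,j)) \<longlonglongrightarrow> L $$ (i,j)" by (rule LIM_zero_cancel)
qed (use assms in auto)

lemma tconvI_inverse_Suc:
  assumes "\<And>k. is_triple m n (X k)" "is_triple m n T" "\<And>k. triple_close (inverse (real (Suc k))) T (X k)"
  shows "tconv m n X T"
  using assms unfolding tconv_def is_triple_def triple_close_def split_beta
  by (intro conjI mconvI_inverse_Suc) (auto simp: split_beta)

section \<open>Closure and interior in terms of sequences\<close>

definition adherent :: "nat \<Rightarrow> nat \<Rightarrow> ctriple set \<Rightarrow> ctriple \<Rightarrow> bool" where
  "adherent m n Z T \<longleftrightarrow> (\<exists>X. (\<forall>k. X k \<in> Z) \<and> tconv m n X T)"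

definition interior_point :: "nat \<Rightarrow> nat \<Rightarrow> ctriple set \<Rightarrow> ctriple \<Rightarrow> bool" where
  "interior_point m n Z T \<longleftrightarrow> (\<exists>e>0. \<forall>T'. is_triple m n T' \<and> triple_close e T T' \<longrightarrow> T' \<in> Z)"

lemma interior_point_eventually:
  assumes "interior_point m n Z T" "tconv m n X T" shows "\<forall>\<^sub>F k in sequentially. X k \<in> Z"
proof -
  obtain e where e: "e > 0" "\<And>T'. is_triple m n T' \<Longrightarrow> triple_close e T T' \<Longrightarrow> T' \<in> Z"
    using assms(1) unfolding interior_point_def by blast
  show ?thesis using tconv_eventually_close[OF assms(2) e(1)]
    by eventually_elim (rule e(2)[OF tconv_is_triple(1)[OF assms(2)]])
qed

text \<open>Otherwise there is, for every k, a point outside \<open>Z\<close> at distance below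
  1/(k+1); these points converge to \<open>T\<close> and never enter \<open>Z\<close>.\<close>

lemma interior_pointI_eventually:
  assumes T: "is_triple m n T" and X: "\<And>X. tconv m n X T \<Longrightarrow> \<forall>\<^sub>F k in sequentially. X k \<in> Z"
  shows "interior_point m n Z T"
proof (rule ccontr)
  assume "\<not> interior_point m n Z T"
  then have "\<exists>T'. is_triple m n T' \<and> triple_close (inverse (real (Suc k))) T T' \<and> T' \<notin> Z" for k
    unfolding interior_point_def using inverse_positive_iff_positive[of "real (Suc k)"] of_nat_0_less_iff by blast
  then obtain X where X': "\<And>k. is_triple m n (X k)" "\<And>k. triple_close (inverse (real (Suc k))) T (X k)" "\<And>k. X k \<notin> Z"
    by metis
  then show False using X[OF tconvI_inverse_Suc[OF X'(1) T X'(2)]] by simp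
qed

text \<open>Translates between the sequences of the arguments and the balls of
  \<open>triples_dense\<close>.\<close>

lemma adherent_iff_close:
  assumes T: "is_triple m n T" and Z: "Z \<subseteq> {T. is_triple m n T}"
  shows "adherent m n Z T \<longleftrightarrow> (\<forall>e>0. \<exists>T'\<in>Z. triple_close e T T')"
proof
  assume "adherent m n Z T"
  then obtain X where X: "\<And>k. X k \<in> Z" "tconv m n X T" unfolding adherent_def by blast
  show "\<forall>e>0. \<exists>T'\<in>Z. triple_close e T T'"
  proof (intro allI impI)
    fix e :: real assume "e > 0"
    from eventually_happens[OF tconv_eventually_close[OF X(2) this]] X(1)
    show "\<exists>T'\<in>Z. triple_close e T T'" by auto
  qed
next
  assume "\<forall>e>0. \<exists>T'\<in>Z. triple_close e T T'"
  then have "\<exists>T'. T' \<in> Z \<and> triple_close (inverse (real (Suc k))) T T'" for k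
    using inverse_positive_iff_positive[of "real (Suc k)"] of_nat_0_less_iff by blast
  then obtain X where X: "\<And>k. X k \<in> Z" "\<And>k. triple_close (inverse (real (Suc k))) T (X k)" by metis
  have "tconv m n X T" using X Z T by (intro tconvI_inverse_Suc) auto
  then show "adherent m n Z T" using X unfolding adherent_def by blast
qed

lemma triple_close_triangle:
  assumes "triple_close e T1 T2" "triple_close d T2 T3" "is_triple m n T1" "is_triple m n T2"
  shows "triple_close (e + d) T1 T3"
proof -
  have tri: "cmod (M1 $$ ij - M3 $$ ij) < e + d"
    if "cmod (M1 $$ ij - M2 $$ ij) < e" "cmod (M2 $$ ij - M3 $$ ij) < d" for M1 M2 M3 :: "complex mat" and ij
    using that norm_triangle_ineq[of "M1 $$ ij - M2 $$ ij" "M2 $$ ij - M3 $$ ij"] by simp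
  obtain C1 B1 A1 C2 B2 A2 C3 B3 A3 where T: "T1 = (C1,B1,A1)" "T2 = (C2,B2,A2)" "T3 = (C3,B3,A3)"
    by (cases T1; cases T2; cases T3) blast
  have d: "dim_row C1 = m" "dim_col C1 = n" "dim_row B1 = m" "dim_col B1 = m" "dim_row A1 = m" "dim_col A1 = m"
    "dim_row C2 = m" "dim_col C2 = n" "dim_row B2 = m" "dim_col B2 = m" "dim_row A2 = m" "dim_col A2 = m"
    using assms(3,4) unfolding T is_triple_def by auto
  show ?thesis using assms(1,2) unfolding triple_close_def T prod.case d
    by (intro conjI allI impI; elim conjE)
      (rule tri[where ?M2.0 = C2] tri[where ?M2.0 = B2] tri[where ?M2.0 = A2]; simp)+
qed

text \<open>Allows nondegeneracy assumptions to be removed one at a time by perturbation. Half of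
  \<open>e\<close> is spent on reaching \<open>X k\<close>, the other half on reaching
  \<open>Z\<close>.\<close>

lemma adherent_limit:
  assumes Z: "Z \<subseteq> {T. is_triple m n T}" and X: "tconv m n X T" and a: "\<And>k. adherent m n Z (X k)"
  shows "adherent m n Z T"
proof -
  have T: "is_triple m n T" and Xk: "\<And>k. is_triple m n (X k)" using tconv_is_triple[OF X] by auto
  show ?thesis unfolding adherent_iff_close[OF T Z]
  proof (intro allI impI)
    fix e :: real assume "e > 0"
    then have e: "e / 2 > 0" by simp
    from eventually_happens[OF tconv_eventually_close[OF X e]] obtain k where k: "triple_close (e/2) T (X k)" by auto
    from a[of k] e obtain T' where T': "T' \<in> Z" "triple_close (e/2) (X k) T'"
      unfolding adherent_iff_close[OF Xk Z] by blast
    have "triple_close (e/2 + e/2) T T'" by (rule triple_close_triangle[OF k T'(2) T Xk])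
    then show "\<exists>T'\<in>Z. triple_close e T T'" using T'(1) by auto
  qed
qed

section \<open>Orbits, their closure and their interior\<close>

definition orbit :: "nat \<Rightarrow> nat \<Rightarrow> ctriple \<Rightarrow> ctriple set" where
  "orbit m n T = {T'. is_triple m n T' \<and> feedback_similar m n T T'}"

lemma orbit_triples: "orbit m n T \<subseteq> {T. is_triple m n T}" by (auto simp: orbit_def)

lemma orbit_similar:
  "is_triple m n T0 \<Longrightarrow> T \<in> orbit m n T0 \<Longrightarrow> feedback_similar m n T T' \<Longrightarrow> T' \<in> orbit m n T0"
  unfolding orbit_def using feedback_trans is_triple_feedback by blast

text \<open>A fixed group element acts continuously and maps the orbit into itself, so it can be
  applied to an approximating sequence.\<close>

lemma adherent_similar:
  assumes "is_triple m n T0" "adherent m n (orbit m n T0) T" "feedback_similar m n T T'"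
  shows "adherent m n (orbit m n T0) T'"
proof -
  obtain X where X: "\<And>k. X k \<in> orbit m n T0" "tconv m n X T" using assms(2) unfolding adherent_def by blast
  obtain P V U S S' where g: "gelt m n P V U S S'" "T' = act P V U S S' T"
    using assms(3) feedback_similar_act by metis
  have "tconv m n (\<lambda>k. act P V U S S' (X k)) T'" unfolding g(2) by (rule tconv_act[OF g(1) X(2)])
  moreover have "act P V U S S' (X k) \<in> orbit m n T0" for k
    by (rule orbit_similar[OF assms(1) X(1) feedback_actI[OF g(1)]])
  ultimately show ?thesis unfolding adherent_def by (intro exI[of _ "\<lambda>k. act P V U S S' (X k)"]) auto
qed

lemma adherent_similar':
  assumes "is_triple m n T0" "is_triple m n T" "feedback_similar m n T T'" "adherent m n (orbit m n T0) T'"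
  shows "adherent m n (orbit m n T0) T"
  using adherent_similar[OF assms(1,4) feedback_sym[OF assms(2,3)]] .

text \<open>A group element moves a sequence tending to \<open>T'\<close> to one tending to
  \<open>T\<close>, which eventually lies in the orbit; moving back does not leave the
  orbit.\<close>

lemma interior_point_similar:
  assumes T0: "is_triple m n T0" and i: "interior_point m n (orbit m n T0) T" and T: "is_triple m n T" and f: "feedback_similar m n T T'"
  shows "interior_point m n (orbit m n T0) T'"
proof (rule interior_pointI_eventually)
  show T': "is_triple m n T'" using is_triple_feedback[OF f T] .
  fix X assume X: "tconv m n X T'"
  obtain P V U S S' where g: "gelt m n P V U S S'" "T = act P V U S S' T'"
    using feedback_sym[OF T f] feedback_similar_act by metis
  have "tconv m n (\<lambda>k. act P V U S S' (X k)) T" unfolding g(2) by (rule tconv_act[OF g(1) X])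
  from interior_point_eventually[OF i this] show "\<forall>\<^sub>F k in sequentially. X k \<in> orbit m n T0"
  proof eventually_elim
    case (elim k)
    have "feedback_similar m n (act P V U S S' (X k)) (X k)"
      by (rule feedback_sym[OF tconv_is_triple(1)[OF X] feedback_actI[OF g(1)]])
    with elim show ?case by (rule orbit_similar[OF T0])
  qed
qed

subsection \<open>Open and dense orbits\<close>

context reduction
begin

lemma block_carrier:
  "C0 \<in> carrier_mat m n" "\<rho> \<in> carrier_mat n m" "\<iota> \<in> carrier_mat m p" "\<pi> \<in> carrier_mat p m"
  "\<epsilon>i \<in> carrier_mat m q" "\<epsilon>p \<in> carrier_mat q m" "\<tau> \<in> carrier_mat m p" "\<sigma> \<in> carrier_mat p m"
  by (intro carrier_matI; simp)+

lemmas block_mconv = block_carrier[THEN mconv_const]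

lemma is_triple_Lop: "is_triple p q Y \<Longrightarrow> is_triple m n (Lop Y)"
  using Lop_eq_K is_triple_K block_carrier cat_carrier by simp

lemma SC_dim [simp]: "dim_row (SC C) = m" "dim_col (SC C) = m"
  by (simp_all add: SC_def)

lemma W_dim [simp]: "dim_row (W B2) = m" "dim_col (W B2) = m"
  by (simp_all add: W_def)

lemma mconv_SC: "mconv m n X C \<Longrightarrow> mconv m m (\<lambda>k. SC (X k)) (SC C)"
  unfolding SC_def by (assumption | rule block_mconv mconv_add mconv_mult)+

lemma mconv_W: "mconv p m X B2 \<Longrightarrow> mconv m m (\<lambda>k. W (X k)) (W B2)"
  unfolding W_def by (assumption | rule block_mconv mconv_add mconv_mult)+

lemma tconv_K: "mconv p m X B2 \<Longrightarrow> mconv p m Y A2 \<Longrightarrow> tconv m n (\<lambda>k. K (X k) (Y k)) (K B2 A2)"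
  unfolding K_def tconv_triple by (assumption | rule conjI block_mconv mconv_mult)+

lemma mconv_cat:
  assumes "tconv p q X Y" shows "mconv p m (\<lambda>k. cat (X k)) (cat Y)"
proof -
  have "mconv p m (\<lambda>k. fst (X k) * \<epsilon>p + (fst (snd (X k)) * \<sigma> + snd (snd (X k)) * \<pi>))
     (fst Y * \<epsilon>p + (fst (snd Y) * \<sigma> + snd (snd Y) * \<pi>))"
    using assms unfolding tconv_def by (elim conjE) (assumption | rule block_mconv mconv_add mconv_mult)+
  then show ?thesis by (simp add: cat_def split_beta)
qed

lemma tconv_uncat: "mconv p m X M \<Longrightarrow> tconv p q (\<lambda>k. uncat (X k)) (uncat M)"
  unfolding uncat_def tconv_triple by (assumption | rule conjI block_mconv mconv_mult)+

lemma SC_aff: "C \<in> carrier_mat m n \<Longrightarrow> SC (aff t C C0) = aff t (SC C) (1\<^sub>m m)"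
  unfolding SC_C0[symmetric] by (simp add: SC_def aff_mult aff_add)

lemma W_aff: "B2 \<in> carrier_mat p m \<Longrightarrow> W (aff t B2 \<sigma>) = aff t (W B2) (1\<^sub>m m)"
  unfolding W_\<sigma>[symmetric] by (simp add: W_def mult_aff aff_add)

text \<open>Near \<open>Lop Y0\<close> the matrices formed by \<open>SC\<close> and \<open>W\<close>
  are near the identity, so every normalisation step can be carried out, and the resulting p x
  (q,p,p) triples tend to \<open>Y0\<close>. Eventually they lie in its orbit, and
  \<open>feedback_Lop\<close> lifts this.\<close>

lemma interior_point_Lop:
  assumes Y0: "is_triple p q Y0" and i: "interior_point p q (orbit p q Y0) Y0"
  shows "interior_point m n (orbit m n (Lop Y0)) (Lop Y0)"
proof (rule interior_pointI_eventually)
  show T0: "is_triple m n (Lop Y0)" by (rule is_triple_Lop[OF Y0])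
  fix X assume X: "tconv m n X (Lop Y0)"
  define C where "C k = fst (X k)" for k
  define B where "B k = fst (snd (X k))" for k
  define A where "A k = snd (snd (X k))" for k
  have X_eq: "X k = (C k, B k, A k)" for k unfolding C_def B_def A_def by simp
  have CBA: "mconv m n C C0" "mconv m m B (\<iota> * \<sigma>)" "mconv m m A (\<iota> * cat Y0)"
    using X unfolding Lop_eq_K[OF Y0] K_def C_def B_def A_def tconv_def by simp_all
  have S: "mconv m m (\<lambda>k. SC (C k)) (1\<^sub>m m)" using mconv_SC[OF CBA(1)] by (simp add: SC_C0)
  then obtain V where V: "mconv m m V (1\<^sub>m m)"
     "\<forall>\<^sub>F k in sequentially. SC (C k) * V k = 1\<^sub>m m \<and> V k * SC (C k) = 1\<^sub>m m"
    by (rule mconv_inverse_one)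
  \<comment> \<open>These are the last p rows of \<open>B\<close> and \<open>A\<close> after the
    change of basis that turns \<open>C\<close> into \<open>C0\<close>.\<close>
  define B2 where "B2 k = \<pi> * (V k * (B k * SC (C k)))" for k
  define A2 where "A2 k = \<pi> * (V k * (A k * SC (C k)))" for k
  have "mconv p m B2 (\<pi> * (1\<^sub>m m * (\<iota> * \<sigma> * 1\<^sub>m m)))" "mconv p m A2 (\<pi> * (1\<^sub>m m * (\<iota> * cat Y0 * 1\<^sub>m m)))"
    unfolding B2_def A2_def by (rule V(1) CBA S block_mconv mconv_mult)+
  moreover have "\<pi> * (1\<^sub>m m * (\<iota> * \<sigma> * 1\<^sub>m m)) = \<sigma>" "\<pi> * (1\<^sub>m m * (\<iota> * cat Y0 * 1\<^sub>m m)) = cat Y0"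
    using cat_carrier[OF Y0] by (simp_all add: mat_norm block_id_left)
  ultimately have B2: "mconv p m B2 \<sigma>" and A2: "mconv p m A2 (cat Y0)" by simp_all
  have "mconv m m (\<lambda>k. W (B2 k)) (1\<^sub>m m)" using mconv_W[OF B2] by (simp add: W_\<sigma>)
  then obtain V2 where V2: "mconv m m V2 (1\<^sub>m m)"
     "\<forall>\<^sub>F k in sequentially. W (B2 k) * V2 k = 1\<^sub>m m \<and> V2 k * W (B2 k) = 1\<^sub>m m"
    by (rule mconv_inverse_one)
  have A3: "mconv p m (\<lambda>k. A2 k * V2 k) (cat Y0)"
    using mconv_mult[OF A2 V2(1)] cat_carrier[OF Y0] by (simp add: one_mult_dim)
  have "tconv p q (\<lambda>k. uncat (A2 k * V2 k)) Y0"
    using tconv_uncat[OF A3] uncat_cat[OF Y0] by simp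
  from interior_point_eventually[OF i this] V(2) V2(2) show "\<forall>\<^sub>F k in sequentially. X k \<in> orbit m n (Lop Y0)"
  proof eventually_elim
    case (elim k)
    define Y where "Y = uncat (A2 k * V2 k)"
    have Yt: "is_triple p q Y" unfolding Y_def by (rule is_triple_uncat[OF mconvD(1)[OF A3]])
    have Xt: "is_triple m n (X k)" by (rule tconv_is_triple(1)[OF X])
    have 1: "feedback_similar m n (X k) (C0, V k * (B k * SC (C k)), V k * (A k * SC (C k)))"
      unfolding X_eq using elim CBA V by (intro feedback_C0) (auto dest: mconvD(1))
    have 2: "feedback_similar m n (C0, V k * (B k * SC (C k)), V k * (A k * SC (C k))) (K (B2 k) (A2 k))"
      unfolding B2_def A2_def by (rule feedback_K; rule carrier_matI; simp add: mconvD(3,4)[OF V(1)])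
    have "feedback_similar m n (K (B2 k) (A2 k)) (K \<sigma> (A2 k * V2 k))"
      using elim by (intro feedback_W mconvD(1)[OF B2] mconvD(1)[OF A2] mconvD(1)[OF V2(1)]) auto
    then have 3: "feedback_similar m n (K (B2 k) (A2 k)) (Lop Y)"
      using Lop_eq_K[OF Yt] cat_uncat[OF mconvD(1)[OF A3]] unfolding Y_def by simp
    have "feedback_similar p q Y Y0" using elim Yt Y0 feedback_sym unfolding orbit_def Y_def by auto
    then have 4: "feedback_similar m n (Lop Y) (Lop Y0)" by (rule feedback_Lop[OF Yt])
    have "feedback_similar m n (X k) (Lop Y0)"
      using feedback_trans[OF Xt feedback_trans[OF Xt feedback_trans[OF Xt 1 2] 3] 4] .
    then show ?case unfolding orbit_def using Xt feedback_sym by auto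
  qed
qed

text \<open>Runs through the normalisation backwards, from \<open>K \<sigma> M\<close> to an
  arbitrary triple. Where a step needs \<open>W\<close> or \<open>SC\<close> to be invertible, the
  claim is shown under that assumption first and then extended by a limit.\<close>

lemma adherent_Lop:
  assumes Y0: "is_triple p q Y0" and a: "\<And>Y. is_triple p q Y \<Longrightarrow> adherent p q (orbit p q Y0) Y"
    and T: "is_triple m n T"
  shows "adherent m n (orbit m n (Lop Y0)) T"
proof -
  define Z where "Z = orbit m n (Lop Y0)"
  have T0: "is_triple m n (Lop Y0)" by (rule is_triple_Lop[OF Y0])
  have Zt: "Z \<subseteq> {T. is_triple m n T}" unfolding Z_def by (rule orbit_triples)
  note adh_sim = adherent_similar'[OF T0, folded Z_def]
  have 1: "adherent m n Z (K \<sigma> M)" if M: "M \<in> carrier_mat p m" for M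
  proof -
    have Y: "is_triple p q (uncat M)" by (rule is_triple_uncat[OF M])
    from a[OF Y] obtain X where X: "\<And>k. X k \<in> orbit p q Y0" "tconv p q X (uncat M)"
      unfolding adherent_def by blast
    have Xt: "is_triple p q (X k)" for k using tconv_is_triple(1)[OF X(2)] .
    have "tconv m n (\<lambda>k. K \<sigma> (cat (X k))) (K \<sigma> M)"
      using tconv_K[OF block_mconv(8) mconv_cat[OF X(2)]] unfolding cat_uncat[OF M] .
    moreover have "K \<sigma> (cat (X k)) \<in> Z" for k
      using X(1)[of k] feedback_Lop[OF Y0, of "X k"] is_triple_Lop[OF Xt, of k]
      unfolding Z_def orbit_def Lop_eq_K[OF Xt, symmetric] by simp
    ultimately show ?thesis unfolding adherent_def by (intro exI[of _ "\<lambda>k. K \<sigma> (cat (X k))"]) simp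
  qed
  have 2: "adherent m n Z (K B2 A2)"
    if c: "B2 \<in> carrier_mat p m" "A2 \<in> carrier_mat p m" and d: "det (W B2) \<noteq> 0" for B2 A2
  proof -
    have "W B2 \<in> carrier_mat m m" by (rule carrier_matI) simp_all
    then obtain V where V: "V \<in> carrier_mat m m" "W B2 * V = 1\<^sub>m m" "V * W B2 = 1\<^sub>m m"
      using d by (rule det_nonzero_inverse)
    show ?thesis
      by (rule adh_sim[OF is_triple_K[OF c] feedback_W[OF c V] 1]) (use c V in auto)
  qed
  have 3: "adherent m n Z (K B2 A2)"
    if c: "B2 \<in> carrier_mat p m" "A2 \<in> carrier_mat p m" for B2 A2
  proof -
    have "W B2 \<in> carrier_mat m m" by (rule carrier_matI) simp_all
    then obtain t where t: "t \<longlonglongrightarrow> 0" "\<And>k. det (aff (t k) (W B2) (1\<^sub>m m)) \<noteq> 0"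
      by (rule aff_one_invertible) blast
    \<comment> \<open>\<open>W\<close> is affine and \<open>W \<sigma>\<close> is the identity, so
      moving \<open>B2\<close> towards \<open>\<sigma>\<close> moves \<open>W B2\<close> along the
      segment to the identity.\<close>
    have "tconv m n (\<lambda>k. K (aff (t k) B2 \<sigma>) A2) (K B2 A2)"
      by (rule tconv_K mconv_aff t(1) c block_carrier mconv_const)+
    then show ?thesis
      by (rule adherent_limit[OF Zt]) (rule 2, auto simp: W_aff c t(2) intro!: carrier_matI)
  qed
  have 4: "adherent m n Z (C0, B, A)" if c: "B \<in> carrier_mat m m" "A \<in> carrier_mat m m" for B A
    by (rule adh_sim[OF _ feedback_K[OF c] 3])
      (use c block_carrier in \<open>auto simp: is_triple_def intro!: carrier_matI\<close>)
  have 5: "adherent m n Z (C, B, A)"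
    if c: "C \<in> carrier_mat m n" "B \<in> carrier_mat m m" "A \<in> carrier_mat m m" and d: "det (SC C) \<noteq> 0" for C B A
  proof -
    have "SC C \<in> carrier_mat m m" by (rule carrier_matI) simp_all
    then obtain V where V: "V \<in> carrier_mat m m" "SC C * V = 1\<^sub>m m" "V * SC C = 1\<^sub>m m"
      using d by (rule det_nonzero_inverse)
    show ?thesis
      by (rule adh_sim[OF _ feedback_C0[OF c V] 4]) (use c V in \<open>auto simp: is_triple_def intro!: carrier_matI\<close>)
  qed
  obtain C B A where CBA: "T = (C,B,A)" by (cases T) auto
  have c: "C \<in> carrier_mat m n" "B \<in> carrier_mat m m" "A \<in> carrier_mat m m"
    using T unfolding CBA is_triple_def by auto
  have "SC C \<in> carrier_mat m m" by (rule carrier_matI) simp_all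
  then obtain t where t: "t \<longlonglongrightarrow> 0" "\<And>k. det (aff (t k) (SC C) (1\<^sub>m m)) \<noteq> 0"
    by (rule aff_one_invertible) blast
  have "tconv m n (\<lambda>k. (aff (t k) C C0, B, A)) T"
    unfolding CBA tconv_triple by (rule conjI mconv_aff t(1) c block_carrier mconv_const)+
  then show ?thesis unfolding Z_def[symmetric]
    by (rule adherent_limit[OF Zt]) (rule 5, auto simp: SC_aff c t(2) intro!: carrier_matI)
qed

end

section \<open>The base case of at least as many columns as rows\<close>

locale full_rank =
  fixes m n :: nat
  assumes le: "m \<le> n"
begin

definition "F = sel m n 0"
definition "G = tsel n m 0"
text \<open>The square matrix with \<open>C\<close> on top of the rows [0 I]; its inverse serves as
  \<open>P\<close> and turns \<open>C\<close> into \<open>F\<close>.\<close>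

definition "WB C = G * C + tsel n (n - m) m * sel (n - m) n m"

lemma base_dim [simp]: "dim_row F = m" "dim_col F = n" "dim_row G = n" "dim_col G = m"
   "dim_row (WB C) = n" "dim_col (WB C) = n"
  by (simp_all add: F_def G_def WB_def)

lemma F_eq_Fmat: "F = Fmat m n"
  unfolding F_def sel_def Fmat_def by (rule eq_matI) auto

lemma F_G: "F * G = 1\<^sub>m m" unfolding F_def G_def using le by (simp add: sel_tsel_same)

lemma WB_F: "WB F = 1\<^sub>m n"
  unfolding WB_def F_def G_def using le by (auto simp: tsel_sel intro!: eq_matI)

lemma F_WB:
  assumes "C \<in> carrier_mat m n" shows "F * WB C = C"
proof -
  have "F * tsel n (n - m) m = 0\<^sub>m m (n - m)" unfolding F_def using le by (simp add: sel_tsel_disjoint)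
  then show ?thesis unfolding WB_def using assms by (simp add: mat_norm F_G[THEN left_cancel_dim] left_cancel_dim[of F "tsel n (n - m) m"])
qed

lemma WB_aff: "C \<in> carrier_mat m n \<Longrightarrow> WB (aff t C F) = aff t (WB C) (1\<^sub>m n)"
  unfolding WB_F[symmetric] by (simp add: WB_def mult_aff aff_add)

lemma mconv_WB: "mconv m n X C \<Longrightarrow> mconv n n (\<lambda>k. WB (X k)) (WB C)"
  unfolding WB_def by (assumption | rule mconv_add mconv_mult mconv_const carrier_matI | simp)+

lemma is_triple_base: "is_triple m n (F, 0\<^sub>m m m, 0\<^sub>m m m)"
  unfolding is_triple_def by (auto intro!: carrier_matI)

text \<open>Since \<open>C * V = F\<close> and \<open>F * G\<close> is the identity, the feedback
  \<open>- (V * (G * B))\<close> contributes exactly \<open>- B\<close>, and likewise for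
  \<open>A\<close>.\<close>

lemma feedback_base:
  assumes C: "C \<in> carrier_mat m n" and BA: "B \<in> carrier_mat m m" "A \<in> carrier_mat m m"
    and V: "V \<in> carrier_mat n n" "WB C * V = 1\<^sub>m n" "V * WB C = 1\<^sub>m n"
  shows "feedback_similar m n (C, B, A) (F, 0\<^sub>m m m, 0\<^sub>m m m)"
  unfolding feedback_similar_act
proof (intro exI conjI)
  show "gelt m n V (- (V * (G * B))) (- (V * (G * A))) (1\<^sub>m m) (1\<^sub>m m)"
    unfolding gelt_def using BA V
    by (auto intro!: invertible_matI[of V n "WB C"] carrier_matI)
  have "C * V = F" using left_cancel_dim[OF F_WB[OF C], of V] V by (simp add: one_mult_dim)
  then have CV: "C * (V * X) = F * X" if "dim_row X = n" for X
    using that C V by (intro left_cancel_dim) auto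
  show "(F, 0\<^sub>m m m, 0\<^sub>m m m) = act V (- (V * (G * B))) (- (V * (G * A))) (1\<^sub>m m) (1\<^sub>m m) (C, B, A)"
    unfolding act_def using C BA V \<open>C * V = F\<close> by (simp add: mat_norm CV F_G[THEN left_cancel_dim])
qed

text \<open>\<open>WB F\<close> is the identity, so \<open>WB\<close> is invertible for all first
  components close to \<open>F\<close>.\<close>

lemma interior_point_base: "interior_point m n (orbit m n (F, 0\<^sub>m m m, 0\<^sub>m m m)) (F, 0\<^sub>m m m, 0\<^sub>m m m)"
proof (rule interior_pointI_eventually)
  show T0: "is_triple m n (F, 0\<^sub>m m m, 0\<^sub>m m m)" by (rule is_triple_base)
  fix X assume X: "tconv m n X (F, 0\<^sub>m m m, 0\<^sub>m m m)"
  then have C: "mconv m n (\<lambda>k. fst (X k)) F" unfolding tconv_def by simp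
  then have "mconv n n (\<lambda>k. WB (fst (X k))) (1\<^sub>m n)" using mconv_WB[OF C] WB_F by simp
  then obtain V where V: "mconv n n V (1\<^sub>m n)"
     "\<forall>\<^sub>F k in sequentially. WB (fst (X k)) * V k = 1\<^sub>m n \<and> V k * WB (fst (X k)) = 1\<^sub>m n"
    by (rule mconv_inverse_one)
  from V(2) show "\<forall>\<^sub>F k in sequentially. X k \<in> orbit m n (F, 0\<^sub>m m m, 0\<^sub>m m m)"
  proof eventually_elim
    case (elim k)
    have Xt: "is_triple m n (X k)" by (rule tconv_is_triple(1)[OF X])
    have "feedback_similar m n (fst (X k), fst (snd (X k)), snd (snd (X k))) (F, 0\<^sub>m m m, 0\<^sub>m m m)"
      using elim Xt mconvD(1)[OF V(1)] by (intro feedback_base[where V = "V k"]) (auto simp: is_triple_def split_beta)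
    then show ?case unfolding orbit_def using Xt feedback_sym by auto
  qed
qed

text \<open>The segment from \<open>C\<close> to \<open>F\<close> has points arbitrarily close to
  \<open>C\<close> at which \<open>WB\<close> is invertible; there the triple lies in the
  orbit.\<close>

lemma adherent_base:
  assumes T: "is_triple m n T" shows "adherent m n (orbit m n (F, 0\<^sub>m m m, 0\<^sub>m m m)) T"
proof -
  obtain C B A where CBA: "T = (C,B,A)" by (cases T) auto
  have c: "C \<in> carrier_mat m n" "B \<in> carrier_mat m m" "A \<in> carrier_mat m m"
    using T unfolding CBA is_triple_def by auto
  have "WB C \<in> carrier_mat n n" by (rule carrier_matI) simp_all
  then obtain t where t: "t \<longlonglongrightarrow> 0" "\<And>k. det (aff (t k) (WB C) (1\<^sub>m n)) \<noteq> 0"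
    by (rule aff_one_invertible) blast
  have "tconv m n (\<lambda>k. (aff (t k) C F, B, A)) T"
    unfolding CBA tconv_triple by (rule conjI mconv_aff t(1) c mconv_const carrier_matI | simp)+
  moreover have "(aff (t k) C F, B, A) \<in> orbit m n (F, 0\<^sub>m m m, 0\<^sub>m m m)" for k
  proof -
    have a: "aff (t k) C F \<in> carrier_mat m n" by (rule carrier_matI) simp_all
    have "WB (aff (t k) C F) \<in> carrier_mat n n" "det (WB (aff (t k) C F)) \<noteq> 0"
      using t(2)[of k] WB_aff[OF c(1)] by (auto intro!: carrier_matI)
    then obtain V where V: "V \<in> carrier_mat n n" "WB (aff (t k) C F) * V = 1\<^sub>m n" "V * WB (aff (t k) C F) = 1\<^sub>m n"
      by (rule det_nonzero_inverse)
    have "is_triple m n (aff (t k) C F, B, A)" using a c by (simp add: is_triple_def)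
    with feedback_base[OF a c(2,3) V] show ?thesis unfolding orbit_def using feedback_sym by auto
  qed
  ultimately show ?thesis unfolding adherent_def by (intro exI[of _ "\<lambda>k. (aff (t k) C F, B, A)"]) simp
qed

end

subsection \<open>Counting parameters\<close>

text \<open>Polynomial functions of degree at most \<open>d\<close> in each of the variables indexed by \<open>I\<close>.\<close>
inductive poly_fun :: "'i set \<Rightarrow> nat \<Rightarrow> (('i \<Rightarrow> complex) \<Rightarrow> complex) \<Rightarrow> bool" for I where
  mono: "(\<And>i. i \<in> I \<Longrightarrow> \<beta> i \<le> d) \<Longrightarrow> poly_fun I d (\<lambda>x. \<Prod>i\<in>I. x i ^ \<beta> i)"
| add: "poly_fun I d f \<Longrightarrow> poly_fun I d g \<Longrightarrow> poly_fun I d (\<lambda>x. f x + g x)"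
| scale: "poly_fun I d f \<Longrightarrow> poly_fun I d (\<lambda>x. c * f x)"

lemma poly_fun_le: "poly_fun I d f \<Longrightarrow> d \<le> e \<Longrightarrow> poly_fun I e f"
proof (induction rule: poly_fun.induct)
  case (mono \<beta> d)
  then show ?case by (intro poly_fun.mono) (meson le_trans)
qed (auto intro: poly_fun.intros)

lemma poly_fun_const: "poly_fun I d (\<lambda>x. c)"
  using poly_fun.scale[OF poly_fun.mono[of I "\<lambda>_. 0" d], of c] by simp

lemma poly_fun_var:
  assumes "finite I" "i \<in> I" "0 < d" shows "poly_fun I d (\<lambda>x. x i)"
proof -
  have "(\<Prod>k\<in>I. x k ^ (if k = i then 1 else 0)) = x i" for x :: "'a \<Rightarrow> complex"
  proof -
    have "(\<Prod>k\<in>I. x k ^ (if k = i then 1 else 0)) = (\<Prod>k\<in>I. if k = i then x k else 1)"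
      by (intro prod.cong) auto
    then show ?thesis using assms by simp
  qed
  with poly_fun.mono[of I "\<lambda>k. if k = i then 1 else 0" d] assms show ?thesis by simp
qed

lemma poly_fun_mult: "poly_fun I d f \<Longrightarrow> poly_fun I e g \<Longrightarrow> poly_fun I (d + e) (\<lambda>x. f x * g x)"
proof (induction rule: poly_fun.induct)
  case (mono \<beta> d)
  from mono(2) show ?case
  proof (induction rule: poly_fun.induct)
    case (mono \<gamma> e)
    have "poly_fun I (d + e) (\<lambda>x. \<Prod>i\<in>I. x i ^ (\<beta> i + \<gamma> i))"
      by (intro poly_fun.mono add_mono mono \<open>\<And>i. i \<in> I \<Longrightarrow> \<beta> i \<le> d\<close>)
    then show ?case by (simp add: power_add prod.distrib)
  next
    case (add e f g)
    then show ?case using poly_fun.add by (auto simp: algebra_simps)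
  next
    case (scale e f c)
    then show ?case using poly_fun.scale[OF scale(2), of c] by (simp add: algebra_simps)
  qed
next
  case (add d f g')
  then show ?case using poly_fun.add by (auto simp: algebra_simps)
next
  case (scale d f c)
  then show ?case using poly_fun.scale[OF scale(2), of c] by (simp add: algebra_simps)
qed

lemma poly_fun_sum: "finite J \<Longrightarrow> (\<And>j. j \<in> J \<Longrightarrow> poly_fun I d (f j)) \<Longrightarrow> poly_fun I d (\<lambda>x. \<Sum>j\<in>J. f j x)"
  by (induction rule: finite_induct) (auto intro: poly_fun_const poly_fun.add)

lemma poly_fun_prod: "finite J \<Longrightarrow> (\<And>j. j \<in> J \<Longrightarrow> poly_fun I d (f j)) \<Longrightarrow> poly_fun I (card J * d) (\<lambda>x. \<Prod>j\<in>J. f j x)"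
  by (induction rule: finite_induct) (auto intro: poly_fun_const poly_fun_mult)

section \<open>Rational maps in few variables do not cover a ball\<close>

lemma nontrivial_kernel:
  fixes M :: "'b \<Rightarrow> 'y \<Rightarrow> complex"
  assumes "finite B" "finite Y" "card B < card Y"
  shows "\<exists>w. (\<exists>y\<in>Y. w y \<noteq> 0) \<and> (\<forall>b\<in>B. (\<Sum>y\<in>Y. w y * M b y) = 0)"
  using assms
proof (induction B arbitrary: Y M rule: finite_induct)
  case empty
  then have "Y \<noteq> {}" by auto
  then show ?case by (intro exI[of _ "\<lambda>_. 1"]) auto
next
  case (insert b B)
  show ?case
  proof (cases "\<forall>y\<in>Y. M b y = 0")
    case True
    with insert.IH[of Y M] insert show ?thesis by auto
  next
    case False
    then obtain y0 where y0: "y0 \<in> Y" "M b y0 \<noteq> 0" by auto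
    \<comment> \<open>One step of Gaussian elimination: equation \<open>b\<close> eliminates the
      unknown at \<open>y0\<close> from the other equations.\<close>
    define M' where "M' c y = M c y - M c y0 * M b y / M b y0" for c y
    have "card B < card (Y - {y0})" using insert y0 by simp
    with insert.IH[of "Y - {y0}" M'] insert.prems obtain w where
      w: "\<exists>y\<in>Y - {y0}. w y \<noteq> 0" "\<forall>c\<in>B. (\<Sum>y\<in>Y - {y0}. w y * M' c y) = 0" by auto
    define u where "u = (\<Sum>y\<in>Y - {y0}. w y * M b y)"
    \<comment> \<open>The value at \<open>y0\<close> is the one that makes equation \<open>b\<close>
      hold.\<close>
    define w' where "w' = w(y0 := - u / M b y0)"
    have s: "(\<Sum>y\<in>Y. w' y * M c y) = - u / M b y0 * M c y0 + (\<Sum>y\<in>Y - {y0}. w y * M c y)" for c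
      using y0 insert.prems by (subst sum.remove[of Y y0]) (auto simp: w'_def intro!: sum.cong)
    have "(\<Sum>y\<in>Y. w' y * M b y) = 0" using y0 unfolding s u_def by simp
    moreover have "(\<Sum>y\<in>Y. w' y * M c y) = 0" if "c \<in> B" for c
    proof -
      have "0 = (\<Sum>y\<in>Y - {y0}. w y * M c y - M c y0 / M b y0 * (w y * M b y))"
        using w(2) that by (auto simp: M'_def algebra_simps)
      also have "\<dots> = (\<Sum>y\<in>Y - {y0}. w y * M c y) - M c y0 / M b y0 * u"
        by (simp add: sum_subtractf sum_distrib_left u_def)
      finally show ?thesis unfolding s by (simp add: algebra_simps)
    qed
    moreover have "\<exists>y\<in>Y. w' y \<noteq> 0" using w(1) unfolding w'_def by auto
    ultimately show ?thesis by blast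
  qed
qed

text \<open>By linearity it is enough to test monomials; \<open>PiE\<close> keeps the set of
  exponents finite for finite \<open>I\<close>.\<close>

lemma poly_fun_annihilated:
  assumes "poly_fun I d f"
    and "\<And>\<beta>. \<beta> \<in> PiE I (\<lambda>_. {..d}) \<Longrightarrow> (\<Sum>y\<in>Y. w y * (\<Prod>i\<in>I. g y i ^ \<beta> i)) = 0"
  shows "(\<Sum>y\<in>Y. w y * f (g y)) = 0"
  using assms
proof (induction rule: poly_fun.induct)
  case (mono \<beta> d)
  have "restrict \<beta> I \<in> PiE I (\<lambda>_. {..d})" using mono by auto
  from mono(2)[OF this] show ?case by simp
next
  case (add d f g)
  then show ?case by (simp add: algebra_simps sum.distrib)
next
  case (scale d f c)
  have "(\<Sum>y\<in>Y. w y * (c * f (g y))) = c * (\<Sum>y\<in>Y. w y * f (g y))"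
    by (simp add: sum_distrib_left algebra_simps)
  with scale show ?case by simp
qed

text \<open>For D = (c+1)^a, the bound cD+1 <= (c+1)(D+1) makes the left-hand side at most D
  (D+1)^a, which is below (D+1)^(a+1).\<close>

lemma power_growth:
  fixes a b c :: nat
  assumes "a < b" obtains D where "(c * D + 1) ^ a < (D + 1) ^ b"
proof
  let ?D = "(c + 1) ^ a"
  have "(c * ?D + 1) ^ a \<le> ((c + 1) * (?D + 1)) ^ a" by (intro power_mono) auto
  also have "\<dots> = ?D * (?D + 1) ^ a" by (rule power_mult_distrib)
  also have "\<dots> < (?D + 1) ^ Suc a" by simp
  also have "\<dots> \<le> (?D + 1) ^ b" using assms by (intro power_increasing) auto
  finally show "(c * ?D + 1) ^ a < (?D + 1) ^ b" .
qed

text \<open>With more grid points than monomials, some nonzero weights \<open>w\<close> on the grid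
  annihilate all polynomials in the parameters up to the degree bound. The Lagrange polynomial of a
  point with nonzero weight violates this.\<close>

lemma no_rational_cover:
  fixes N :: "'j \<Rightarrow> ('i \<Rightarrow> complex) \<Rightarrow> complex" and \<delta> :: "('i \<Rightarrow> complex) \<Rightarrow> complex"
  assumes fin: "finite I" "finite J" and card: "card I < card J"
    and poly_fun: "\<And>j. j \<in> J \<Longrightarrow> poly_fun I d (N j)" "poly_fun I d \<delta>" and e: "0 < e"
    and cover: "\<And>y. (\<And>j. j \<in> J \<Longrightarrow> cmod (y j - b j) < e) \<Longrightarrow> \<exists>g. \<delta> g \<noteq> 0 \<and> (\<forall>j\<in>J. y j * \<delta> g = N j g)"
  shows False
proof -
  \<comment> \<open>On the right stands the number of grid points. On the left stands the number of
    monomials with exponents up to \<open>card J * d * D\<close>: for each coordinate, D factors of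
    degree d are multiplied.\<close>
  obtain D where D: "(card J * d * D + 1) ^ card I < (D + 1) ^ card J"
    using power_growth[OF card] by blast
  \<comment> \<open>The offsets of the grid from the centre: distinct for k = 0, ..., D and of
    modulus below \<open>e\<close>.\<close>
  define v where "v k = complex_of_real (e * (real k / real (D + 1)))" for k
  have v_less: "cmod (v k) < e" if "k \<le> D" for k
  proof -
    have "real k / real (D + 1) < 1" using that by simp
    then have "e * (real k / real (D + 1)) < e" using e by (metis mult.right_neutral mult_less_cancel_left_pos)
    then show ?thesis unfolding v_def norm_of_real using e by simp
  qed
  have v_inj: "v k = v l \<Longrightarrow> k = l" for k l using e unfolding v_def by (simp del: of_real_mult of_real_divide)
  define Y where "Y = PiE J (\<lambda>_. {..D})"
  have Y: "finite Y" "card Y = (D + 1) ^ card J"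
    unfolding Y_def using fin by (auto simp: finite_PiE card_PiE)
  have "\<exists>g. \<delta> g \<noteq> 0 \<and> (\<forall>j\<in>J. (b j + v (y j)) * \<delta> g = N j g)" if "y \<in> Y" for y
    using that by (intro cover) (auto simp: Y_def intro!: v_less)
  then obtain g where g: "\<And>y. y \<in> Y \<Longrightarrow> \<delta> (g y) \<noteq> 0"
    "\<And>y j. y \<in> Y \<Longrightarrow> j \<in> J \<Longrightarrow> N j (g y) = (b j + v (y j)) * \<delta> (g y)" by metis
  define B where "B = PiE I (\<lambda>_. {..card J * (D * d)})"
  have B: "finite B" "card B = (card J * d * D + 1) ^ card I"
    unfolding B_def using fin by (auto simp: finite_PiE card_PiE algebra_simps)
  obtain w y0 where w: "y0 \<in> Y" "w y0 \<noteq> 0" "\<And>\<beta>. \<beta> \<in> B \<Longrightarrow> (\<Sum>y\<in>Y. w y * (\<Prod>i\<in>I. g y i ^ \<beta> i)) = 0"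
    using nontrivial_kernel[OF B(1) Y(1), of "\<lambda>\<beta> y. \<Prod>i\<in>I. g y i ^ \<beta> i"] D B Y by auto
  \<comment> \<open>the Lagrange polynomial of the grid point \<open>y0\<close>, with denominators cleared\<close>
  define f where "f x = (\<Prod>j\<in>J. \<Prod>k\<in>{..D} - {y0 j}. N j x + - (b j + v k) * \<delta> x)" for x
  have "poly_fun I (card J * (D * d)) f"
    unfolding f_def
  proof (intro poly_fun_prod fin)
    fix j assume j: "j \<in> J"
    have "card ({..D} - {y0 j}) = D" using w(1) j unfolding Y_def by (auto simp: PiE_iff)
    moreover have "poly_fun I (card ({..D} - {y0 j}) * d) (\<lambda>x. \<Prod>k\<in>{..D} - {y0 j}. N j x + - (b j + v k) * \<delta> x)"
      by (intro poly_fun_prod poly_fun.add poly_fun.scale poly_fun j) auto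
    ultimately show "poly_fun I (D * d) (\<lambda>x. \<Prod>k\<in>{..D} - {y0 j}. N j x + - (b j + v k) * \<delta> x)" by simp
  qed
  then have "(\<Sum>y\<in>Y. w y * f (g y)) = 0" by (rule poly_fun_annihilated) (use w(3) in \<open>simp add: B_def\<close>)
  moreover have "f (g y) = 0" if y: "y \<in> Y" "y \<noteq> y0" for y
  proof -
    \<comment> \<open>In a coordinate where \<open>y\<close> and \<open>y0\<close> differ, the
      factor with index \<open>y j\<close> vanishes.\<close>
    obtain j where j: "j \<in> J" "y j \<noteq> y0 j" using y w(1) unfolding Y_def by (metis PiE_ext)
    moreover have "y j \<in> {..D} - {y0 j}" using j y unfolding Y_def by auto
    moreover have "N j (g y) + - (b j + v (y j)) * \<delta> (g y) = 0" using g(2)[OF y(1) j(1)] by (simp add: algebra_simps)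
    ultimately have "(\<Prod>k\<in>{..D} - {y0 j}. N j (g y) + - (b j + v k) * \<delta> (g y)) = 0"
      by (intro prod_zero bexI[of _ "y j"]) auto
    then show ?thesis unfolding f_def using j fin by (intro prod_zero bexI[of _ j]) auto
  qed
  ultimately have "w y0 * f (g y0) = 0"
    using Y(1) w(1) by (simp add: sum.remove[of Y y0])
  moreover have "f (g y0) \<noteq> 0"
  proof -
    have "N j (g y0) + - (b j + v k) * \<delta> (g y0) \<noteq> 0" if "j \<in> J" "k \<noteq> y0 j" for j k
    proof -
      \<comment> \<open>At \<open>y0\<close> each factor is a difference of distinct grid values
        times the nonzero denominator.\<close>
      have "N j (g y0) + - (b j + v k) * \<delta> (g y0) = (v (y0 j) - v k) * \<delta> (g y0)"
        using g(2)[OF w(1) that(1)] by (simp add: algebra_simps)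
      then show ?thesis using g(1)[OF w(1)] v_inj that by auto
    qed
    then show ?thesis unfolding f_def using fin by (simp add: prod_zero_iff)
  qed
  ultimately show False using w by simp
qed

section \<open>Matrices with polynomial entries and the orbit of a triple\<close>

definition poly_mat :: "'i set \<Rightarrow> nat \<Rightarrow> nat \<Rightarrow> nat \<Rightarrow> (('i \<Rightarrow> complex) \<Rightarrow> complex mat) \<Rightarrow> bool" where
  "poly_mat I d r c M \<longleftrightarrow> (\<forall>x. M x \<in> carrier_mat r c) \<and> (\<forall>i<r. \<forall>j<c. poly_fun I d (\<lambda>x. M x $$ (i,j)))"

lemma poly_matD:
  assumes "poly_mat I d r c M"
  shows "M x \<in> carrier_mat r c" "dim_row (M x) = r" "dim_col (M x) = c"
    "i < r \<Longrightarrow> j < c \<Longrightarrow> poly_fun I d (\<lambda>x. M x $$ (i,j))"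
  using assms unfolding poly_mat_def by auto

lemma poly_matI:
  assumes "\<And>x. M x \<in> carrier_mat r c" "\<And>i j. i < r \<Longrightarrow> j < c \<Longrightarrow> poly_fun I d (\<lambda>x. M x $$ (i,j))"
  shows "poly_mat I d r c M"
  using assms unfolding poly_mat_def by auto

lemma poly_mat_const: "A \<in> carrier_mat r c \<Longrightarrow> poly_mat I d r c (\<lambda>x. A)"
  by (intro poly_matI poly_fun_const)

lemma poly_mat_mat:
  assumes "\<And>i j. i < r \<Longrightarrow> j < c \<Longrightarrow> poly_fun I d (\<lambda>x. f x (i,j))"
  shows "poly_mat I d r c (\<lambda>x. mat r c (f x))"
  by (rule poly_matI) (auto simp: assms)

lemma poly_mat_add:
  assumes "poly_mat I d r c M" "poly_mat I d r c M'" shows "poly_mat I d r c (\<lambda>x. M x + M' x)"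
proof (rule poly_matI)
  fix i j assume ij: "i < r" "j < c"
  have "poly_fun I d (\<lambda>x. M x $$ (i,j) + M' x $$ (i,j))" by (intro poly_fun.add poly_matD(4)[OF assms(1)] poly_matD(4)[OF assms(2)] ij)
  then show "poly_fun I d (\<lambda>x. (M x + M' x) $$ (i,j))" using ij by (simp add: poly_matD(2,3)[OF assms(2)])
qed (simp add: carrier_matI poly_matD(2,3)[OF assms(2)])

lemma poly_mat_mult:
  assumes "poly_mat I d r s M" "poly_mat I e s c M'" shows "poly_mat I (d + e) r c (\<lambda>x. M x * M' x)"
proof (rule poly_matI)
  fix i j assume ij: "i < r" "j < c"
  have "poly_fun I (d + e) (\<lambda>x. \<Sum>l\<in>{0..<s}. M x $$ (i,l) * M' x $$ (l,j))"
    by (intro poly_fun_sum poly_fun_mult poly_matD(4)[OF assms(1)] poly_matD(4)[OF assms(2)] ij) auto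
  then show "poly_fun I (d + e) (\<lambda>x. (M x * M' x) $$ (i,j))"
    using ij by (simp add: poly_matD(2,3)[OF assms(2)] poly_matD(2,3)[OF assms(1)] scalar_prod_def)
qed (simp add: carrier_matI poly_matD(2,3)[OF assms(2)] poly_matD(2,3)[OF assms(1)])

lemma poly_fun_det:
  assumes M: "poly_mat I d n n M" shows "poly_fun I (n * d) (\<lambda>x. det (M x))"
  unfolding det_def'[OF poly_matD(1)[OF M]]
proof (intro poly_fun_sum poly_fun.scale)
  fix p assume "p \<in> {p. p permutes {0..<n}}"
  then have p: "\<And>i. i < n \<Longrightarrow> p i < n" using permutes_in_image[of p "{0..<n}"] by auto
  have "poly_fun I (card {0..<n} * d) (\<lambda>x. \<Prod>i = 0..<n. M x $$ (i, p i))"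
    by (intro poly_fun_prod poly_matD(4)[OF M]) (auto simp: p)
  then show "poly_fun I (n * d) (\<lambda>x. \<Prod>i = 0..<n. M x $$ (i, p i))" by simp
qed (simp add: finite_permutations)

lemma poly_mat_adj:
  assumes M: "poly_mat I d n n M" shows "poly_mat I (n * d) n n (\<lambda>x. adj_mat (M x))"
  unfolding adj_mat_def poly_matD(2,3)[OF M]
proof (intro poly_mat_mat, unfold prod.case)
  fix i j assume ij: "i < n" "j < n"
  have "poly_fun I ((n - 1) * d) (\<lambda>x. det (mat_delete (M x) j i))"
    unfolding mat_delete_def poly_matD(2,3)[OF M] using ij
    by (intro poly_fun_det poly_mat_mat) (auto intro!: poly_matD(4)[OF M])
  then show "poly_fun I (n * d) (\<lambda>x. cofactor (M x) j i)"
    unfolding cofactor_def by (intro poly_fun.scale) (erule poly_fun_le, simp)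
qed

text \<open>Cramer's rule \<open>adj_mat S = det S \<cdot>\<^sub>m S'\<close> clears the denominator
  \<open>det S\<close> from the action.\<close>

lemma det_times_inverse:
  fixes S :: "complex mat"
  assumes S: "S \<in> carrier_mat m m" "S' \<in> carrier_mat m m" "S * S' = 1\<^sub>m m" "S' * S = 1\<^sub>m m"
    and X: "X \<in> carrier_mat m c" and ij: "i < m" "j < c"
  shows "(S' * X) $$ (i,j) * det S = (adj_mat S * X) $$ (i,j)"
proof -
  have "adj_mat S = adj_mat S * S * S'" using S adj_mat(1)[OF S(1)] by (simp add: mat_norm)
  also have "\<dots> = det S \<cdot>\<^sub>m S'" using S by (simp add: adj_mat(3)[OF S(1)] smult_mult_dim one_mult_dim)
  finally have "adj_mat S * X = det S \<cdot>\<^sub>m (S' * X)" using S X by (simp add: smult_mult_dim)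
  then show ?thesis using S X ij by simp
qed

text \<open>The group has n*n + 2*n*m + m*m parameters and the space m*n + 2*m*m coordinates; the
  hypothesis says that the first number is smaller. The transformed entries are rational in the
  parameters with common denominator \<open>det S\<close>, so \<open>no_rational_cover\<close>
  excludes a ball inside an orbit.\<close>

lemma not_rigid:
  assumes dim: "m * n + n * n < m * m"
  shows "\<not> rigid m n T"
proof
  assume "rigid m n T"
  then obtain e where T: "is_triple m n T" and e: "e > 0"
    "\<And>T'. is_triple m n T' \<Longrightarrow> triple_close e T T' \<Longrightarrow> feedback_similar m n T T'"
    unfolding rigid_def by blast
  obtain C B A where CBA: "T = (C,B,A)" by (cases T) auto
  have c: "C \<in> carrier_mat m n" "B \<in> carrier_mat m m" "A \<in> carrier_mat m m"
    using T unfolding CBA is_triple_def by auto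
  \<comment> \<open>The first component is a tag for the block: 0, 1, 2, 3 stand for
    \<open>P\<close>, \<open>V\<close>, \<open>U\<close>, \<open>S\<close> in \<open>I\<close>, and
    0, 1, 2 for \<open>C\<close>, \<open>B\<close>, \<open>A\<close> in \<open>J\<close>.\<close>
  define I :: "(nat \<times> nat \<times> nat) set" where
    "I = {0} \<times> {..<n} \<times> {..<n} \<union> {1} \<times> {..<n} \<times> {..<m} \<union> {2} \<times> {..<n} \<times> {..<m} \<union> {3} \<times> {..<m} \<times> {..<m}"
  define J :: "(nat \<times> nat \<times> nat) set" where
    "J = {0} \<times> {..<m} \<times> {..<n} \<union> {1} \<times> {..<m} \<times> {..<m} \<union> {2} \<times> {..<m} \<times> {..<m}"
  have finI: "finite I" and finJ: "finite J" unfolding I_def J_def by auto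
  have "card I = n * n + n * m + n * m + m * m"
    unfolding I_def by (subst card_Un_disjoint; (auto simp: card_cartesian_product)[1])+
  moreover have "card J = m * n + m * m + m * m"
    unfolding J_def by (subst card_Un_disjoint; (auto simp: card_cartesian_product)[1])+
  ultimately have card: "card I < card J" using dim by (simp add: mult.commute)
  define P where "P x = mat n n (\<lambda>(i,j). x (0::nat,i,j) :: complex)" for x
  define V where "V x = mat n m (\<lambda>(i,j). x (1::nat,i,j) :: complex)" for x
  define U where "U x = mat n m (\<lambda>(i,j). x (2::nat,i,j) :: complex)" for x
  define S where "S x = mat m m (\<lambda>(i,j). x (3::nat,i,j) :: complex)" for x
  have pP: "poly_mat I 1 n n P" and pV: "poly_mat I 1 n m V" and pU: "poly_mat I 1 n m U" and pS: "poly_mat I 1 m m S"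
    unfolding P_def V_def U_def S_def by (intro poly_mat_mat; simp; intro poly_fun_var finI; simp add: I_def)+
  \<comment> \<open>The numerators of the transformed triple: \<open>adj_mat (S x)\<close> takes the
    place of the inverse of \<open>S x\<close>.\<close>
  define N where "N x k = (if k = (0::nat) then adj_mat (S x) * (C * P x)
     else if k = 1 then adj_mat (S x) * (C * V x + B * S x) else adj_mat (S x) * (C * U x + A * S x))" for x k
  have padj: "poly_mat I m m m (\<lambda>x. adj_mat (S x))" using poly_mat_adj[OF pS] by simp
  have pCP: "poly_mat I 1 m n (\<lambda>x. C * P x)" using poly_mat_mult[OF poly_mat_const[OF c(1), where d = 0] pP] by simp
  have pCV: "poly_mat I 1 m m (\<lambda>x. C * V x)" using poly_mat_mult[OF poly_mat_const[OF c(1), where d = 0] pV] by simp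
  have pCU: "poly_mat I 1 m m (\<lambda>x. C * U x)" using poly_mat_mult[OF poly_mat_const[OF c(1), where d = 0] pU] by simp
  have pBS: "poly_mat I 1 m m (\<lambda>x. B * S x)" using poly_mat_mult[OF poly_mat_const[OF c(2), where d = 0] pS] by simp
  have pAS: "poly_mat I 1 m m (\<lambda>x. A * S x)" using poly_mat_mult[OF poly_mat_const[OF c(3), where d = 0] pS] by simp
  have N0: "poly_mat I (m + 1) m n (\<lambda>x. N x 0)" unfolding N_def using poly_mat_mult[OF padj pCP] by simp
  have N1: "poly_mat I (m + 1) m m (\<lambda>x. N x 1)" unfolding N_def using poly_mat_mult[OF padj poly_mat_add[OF pCV pBS]] by simp
  have N2: "poly_mat I (m + 1) m m (\<lambda>x. N x 2)" unfolding N_def using poly_mat_mult[OF padj poly_mat_add[OF pCU pAS]] by simp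
  define b where "b k = (if fst k = (0::nat) then C else if fst k = 1 then B else A) $$ snd k" for k
  show False
  proof (rule no_rational_cover[OF finI finJ card, where N = "\<lambda>k x. N x (fst k) $$ snd k" and \<delta> = "\<lambda>x. det (S x)" and d = "m + 1" and b = b])
    show "poly_fun I (m + 1) (\<lambda>x. N x (fst k) $$ snd k)" if "k \<in> J" for k
      using that poly_matD(4)[OF N0] poly_matD(4)[OF N1] poly_matD(4)[OF N2] unfolding J_def by auto
    show "poly_fun I (m + 1) (\<lambda>x. det (S x))" by (rule poly_fun_le[OF poly_fun_det[OF pS]]) simp
    show "0 < e" by (rule e)
    fix y :: "nat \<times> nat \<times> nat \<Rightarrow> complex"
    assume y: "\<And>j. j \<in> J \<Longrightarrow> cmod (y j - b j) < e"
    define C' where "C' = mat m n (\<lambda>(i,j). y (0,i,j))"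
    define B' where "B' = mat m m (\<lambda>(i,j). y (1,i,j))"
    define A' where "A' = mat m m (\<lambda>(i,j). y (2,i,j))"
    have "is_triple m n (C',B',A')" unfolding is_triple_def C'_def B'_def A'_def by auto
    moreover have "triple_close e T (C',B',A')"
    proof -
      have "cmod (C $$ (i,j) - y (0,i,j)) < e" if "i < m" "j < n" for i j
        using y[of "(0,i,j)"] that unfolding J_def b_def by (simp add: norm_minus_commute)
      moreover have "cmod (B $$ (i,j) - y (1,i,j)) < e" if "i < m" "j < m" for i j
        using y[of "(1,i,j)"] that unfolding J_def b_def by (simp add: norm_minus_commute)
      moreover have "cmod (A $$ (i,j) - y (2,i,j)) < e" if "i < m" "j < m" for i j
        using y[of "(2,i,j)"] that unfolding J_def b_def by (simp add: norm_minus_commute)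
      ultimately show ?thesis using c unfolding triple_close_def CBA C'_def B'_def A'_def by auto
    qed
    ultimately obtain P1 V1 U1 S1 S1' where g: "gelt m n P1 V1 U1 S1 S1'" "(C',B',A') = act P1 V1 U1 S1 S1' T"
      using e(2) feedback_similar_act by metis
    \<comment> \<open>The point of parameter space that encodes the group element.\<close>
    define x where "x = (\<lambda>(k,i,j). (if k = (0::nat) then P1 else if k = 1 then V1 else if k = 2 then U1 else S1) $$ (i,j))"
    have gc: "P1 \<in> carrier_mat n n" "V1 \<in> carrier_mat n m" "U1 \<in> carrier_mat n m" "S1 \<in> carrier_mat m m" "S1' \<in> carrier_mat m m"
      "S1 * S1' = 1\<^sub>m m" "S1' * S1 = 1\<^sub>m m"
      using g unfolding gelt_def by auto
    have x: "P x = P1" "V x = V1" "U x = U1" "S x = S1"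
      unfolding P_def V_def U_def S_def x_def using gc by (auto intro!: eq_matI)
    have "det S1 * det S1' = 1" using det_mult[OF gc(4,5)] gc(6) by simp
    then have "det (S x) \<noteq> 0" unfolding x by auto
    moreover have "y k * det (S x) = N x (fst k) $$ snd k" if k: "k \<in> J" for k
    proof -
      have E: "C' = S1' * (C * P1)" "B' = S1' * (C * V1 + B * S1)" "A' = S1' * (C * U1 + A * S1)"
        using g(2) unfolding act_def CBA by auto
      note dt = det_times_inverse[OF gc(4,5,6,7)]
      obtain l i j where k': "k = (l,i,j)" by (cases k) auto
      consider "l = 0" "i < m" "j < n" | "l = 1" "i < m" "j < m" | "l = 2" "i < m" "j < m"
        using k unfolding k' J_def by auto
      then show ?thesis
      proof cases
        case 1
        then have "y k = C' $$ (i,j)" unfolding C'_def k' by simp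
        then show ?thesis using dt[OF mult_carrier_mat[OF c(1) gc(1)] 1(2,3)] 1(1)
          unfolding k' E N_def x by (simp del: index_mult_mat)
      next
        case 2
        then have "y k = B' $$ (i,j)" unfolding B'_def k' by simp
        have "C * V1 + B * S1 \<in> carrier_mat m m" using c gc by auto
        from dt[OF this 2(2,3)] show ?thesis using 2(1) \<open>y k = B' $$ (i,j)\<close>
          unfolding k' E N_def x by (simp del: index_mult_mat)
      next
        case 3
        then have "y k = A' $$ (i,j)" unfolding A'_def k' by simp
        have "C * U1 + A * S1 \<in> carrier_mat m m" using c gc by auto
        from dt[OF this 3(2,3)] show ?thesis using 3(1) \<open>y k = A' $$ (i,j)\<close>
          unfolding k' E N_def x by (simp del: index_mult_mat)
      qed
    qed
    ultimately show "\<exists>g. det (S g) \<noteq> 0 \<and> (\<forall>k\<in>J. y k * det (S g) = N g (fst k) $$ snd k)" by blast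
  qed
qed

subsection \<open>Canonical triples\<close>

lemma is_triple_unique: "is_triple m n T \<Longrightarrow> is_triple m' n' T \<Longrightarrow> m = m' \<and> n = n'"
  unfolding is_triple_def by (cases T) (fastforce dest: carrier_matD)

lemma is_triple_Lop_size: "is_triple p q T \<Longrightarrow> is_triple (2 * p + q) (p + q) (Lop T)"
  by (rule reduction.is_triple_Lop[of p q]) (unfold_locales, auto)

lemma is_triple_Lop_pow: "\<exists>p q. is_triple p q ((Lop ^^ l) (Fmat a b, 0\<^sub>m a a, 0\<^sub>m a a))"
proof (induction l)
  case 0
  have "is_triple a b (Fmat a b, 0\<^sub>m a a, 0\<^sub>m a a)" unfolding is_triple_def Fmat_def by simp
  then show ?case by auto
next
  case (Suc l)
  then obtain p q where "is_triple p q ((Lop ^^ l) (Fmat a b, 0\<^sub>m a a, 0\<^sub>m a a))" by blast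
  from is_triple_Lop_size[OF this] show ?case unfolding funpow.simps comp_def by blast
qed

lemma canonical_form_Lop: "canonical_form T \<Longrightarrow> canonical_form (Lop T)"
proof -
  assume "canonical_form T"
  then obtain l p q where "p \<le> q" "T = (Lop ^^ l) (Fmat p q, 0\<^sub>m p p, 0\<^sub>m p p)"
    unfolding canonical_form_def by blast
  then show ?thesis unfolding canonical_form_def by (intro exI[of _ "Suc l"] exI[of _ p] exI[of _ q]) simp
qed

text \<open>A triple determines its sizes, so undoing the last \<open>Lop\<close> also recovers p
  and q from m and n. This drives the uniqueness proof.\<close>

lemma canonical_form_cases:
  assumes "canonical_form T" "is_triple m n T"
  obtains "m \<le> n" "T = (Fmat m n, 0\<^sub>m m m, 0\<^sub>m m m)"
  | p q T' where "is_triple p q T'" "canonical_form T'" "T = Lop T'" "m = 2 * p + q" "n = p + q"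
proof -
  obtain l a b where ab: "a \<le> b" "T = (Lop ^^ l) (Fmat a b, 0\<^sub>m a a, 0\<^sub>m a a)"
    using assms(1) unfolding canonical_form_def by blast
  show thesis
  proof (cases l)
    case 0
    have "is_triple a b (Fmat a b, 0\<^sub>m a a, 0\<^sub>m a a)" unfolding is_triple_def Fmat_def by simp
    then have "m = a \<and> n = b" using is_triple_unique assms(2) ab(2) 0 by simp
    then show thesis using that(1) ab 0 by simp
  next
    case (Suc l')
    define T' where "T' = (Lop ^^ l') (Fmat a b, 0\<^sub>m a a, 0\<^sub>m a a)"
    obtain p q where T': "is_triple p q T'" using is_triple_Lop_pow[of l' a b] unfolding T'_def by blast
    have "T = Lop T'" using ab(2) Suc unfolding T'_def by simp
    moreover have "canonical_form T'" unfolding canonical_form_def T'_def using ab(1) by blast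
    moreover have "m = 2 * p + q \<and> n = p + q"
      using is_triple_unique[OF assms(2)] is_triple_Lop_size[OF T'] \<open>T = Lop T'\<close> by simp
    ultimately show thesis using that(2) T' by blast
  qed
qed

text \<open>For m = n the canonical triple arises in two ways, as a base form and as
  \<open>Lop\<close> of a triple without rows; that both give the same matrices saves
  uniqueness.\<close>

lemma Lop_empty:
  assumes "is_triple 0 q T" shows "Lop T = (Fmat q q, 0\<^sub>m q q, 0\<^sub>m q q)"
  using assms unfolding is_triple_def Lop_def Fmat_def by (auto intro!: eq_matI)

lemma canonical_form_Fmat: "p \<le> q \<Longrightarrow> canonical_form (Fmat p q, 0\<^sub>m p p, 0\<^sub>m p p)"
  unfolding canonical_form_def by (intro exI[of _ 0] exI[of _ p] exI[of _ q]) simp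

text \<open>The induction carries an interior point only at \<open>T0\<close>; the group action
  later spreads it over the whole orbit.\<close>

lemma canonical_form_open_dense:
  assumes "0 < m" "m * m < m * n + n * n"
  shows "\<exists>T0. is_triple m n T0 \<and> canonical_form T0 \<and> (\<forall>T. is_triple m n T \<and> canonical_form T \<longrightarrow> T = T0)
    \<and> interior_point m n (orbit m n T0) T0 \<and> (\<forall>T. is_triple m n T \<longrightarrow> adherent m n (orbit m n T0) T)"
  using assms
proof (induction m arbitrary: n rule: less_induct)
  case (less m)
  show ?case
  proof (cases "m \<le> n")
    case True
    then interpret full_rank m n by unfold_locales
    have "T = (F, 0\<^sub>m m m, 0\<^sub>m m m)" if T: "is_triple m n T" "canonical_form T" for T
      using T(2,1)
    proof (cases rule: canonical_form_cases)
      case (2 p q T')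
      with True have "p = 0" by simp
      with 2 show ?thesis using Lop_empty unfolding F_eq_Fmat by simp
    qed (simp add: F_eq_Fmat)
    then show ?thesis
      using is_triple_base interior_point_base adherent_base canonical_form_Fmat[OF True]
      unfolding F_eq_Fmat by blast
  next
    case False
    \<comment> \<open>If m > 2n, then m*m >= 2*m*n >= m*n + n*n, against the hypothesis.\<close>
    have m2n: "m \<le> 2 * n"
    proof (rule ccontr)
      assume "\<not> m \<le> 2 * n"
      then have "n * 2 * m \<le> m * m" "n * n \<le> m * n" by (intro mult_right_mono; simp)+
      then have "2 * (m * n) \<le> m * m" "n * n \<le> m * n" by (simp_all only: ac_simps)
      then show False using less.prems by linarith
    qed
    define p where "p = m - n"
    define q where "q = 2 * n - m"
    have mn: "m = 2 * p + q" "n = p + q" unfolding p_def q_def using False m2n by auto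
    \<comment> \<open>With n positive, p is smaller than m, so the induction hypothesis
      applies.\<close>
    have "0 < n" using less.prems by (cases n) auto
    then have "p < m" "0 < p" unfolding p_def using False by auto
    \<comment> \<open>This is the identity m*m - m*n - n*n = p*p - p*q - q*q.\<close>
    moreover have "p * p < p * q + q * q" using less.prems unfolding mn by (simp add: algebra_simps)
    ultimately obtain Y0 where Y0: "is_triple p q Y0" "canonical_form Y0"
      "\<And>T. is_triple p q T \<Longrightarrow> canonical_form T \<Longrightarrow> T = Y0" "interior_point p q (orbit p q Y0) Y0"
      "\<And>T. is_triple p q T \<Longrightarrow> adherent p q (orbit p q Y0) T"
      using less.IH by blast
    interpret reduction p q n m by unfold_locales (auto simp: mn)
    have "T = Lop Y0" if T: "is_triple m n T" "canonical_form T" for T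
      using T(2,1)
    proof (cases rule: canonical_form_cases)
      case (2 p' q' T')
      have "p' = p" "q' = q" using 2(4,5) mn by linarith+
      then have "is_triple p q T'" using 2(1) by simp
      then have "T' = Y0" using 2(2) Y0(3) by blast
      then show ?thesis using 2(3) by simp
    qed (use False in simp)
    then show ?thesis
      using is_triple_Lop[OF Y0(1)] canonical_form_Lop[OF Y0(2)] interior_point_Lop[OF Y0(1,4)] adherent_Lop[OF Y0(1,5)]
      by blast
  qed
qed

section \<open>The golden ratio threshold and the set of rigid triples\<close>

lemma golden_ratio_sign:
  fixes m n :: nat
  assumes "0 < m" "0 < n"
  shows "real m < real n * (1 + sqrt 5) / 2 \<longleftrightarrow> m * m < m * n + n * n"
    "real m > real n * (1 + sqrt 5) / 2 \<longleftrightarrow> m * n + n * n < m * m"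
proof -
  define f where "f = real n * (1 + sqrt 5) / 2"
  define h where "h = real m + real n * (sqrt 5 - 1) / 2"
  have "sqrt 5 > 1" by simp
  then have h: "h > 0" unfolding h_def using assms by (simp add: add_pos_nonneg)
  \<comment> \<open>\<open>(1 \<plusminus> sqrt 5) / 2\<close> are the roots of \<open>x\<^sup>2 = x + 1\<close>, and \<open>h\<close> is the factor of the negative root\<close>
  have fac: "real (m * m) - real (m * n + n * n) = (real m - f) * h"
    unfolding f_def h_def by (simp add: field_simps)
  have "real m < f \<longleftrightarrow> (real m - f) * h < 0" "f < real m \<longleftrightarrow> 0 < (real m - f) * h"
    using h by (simp_all add: mult_less_0_iff zero_less_mult_iff)
  then show "real m < real n * (1 + sqrt 5) / 2 \<longleftrightarrow> m * m < m * n + n * n"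
    "real m > real n * (1 + sqrt 5) / 2 \<longleftrightarrow> m * n + n * n < m * m"
    unfolding fac[symmetric] f_def[symmetric] by linarith+
qed

text \<open>The group moves one interior point to every other point of the orbit.\<close>

lemma triples_open_orbit:
  assumes T0: "is_triple m n T0" and i: "interior_point m n (orbit m n T0) T0"
  shows "triples_open m n (orbit m n T0)"
proof -
  have "interior_point m n (orbit m n T0) T" if "T \<in> orbit m n T0" for T
    using interior_point_similar[OF T0 i T0] that unfolding orbit_def by blast
  then show ?thesis unfolding triples_open_def interior_point_def using orbit_triples by blast
qed

lemma triples_dense_orbit:
  assumes "\<And>T. is_triple m n T \<Longrightarrow> adherent m n (orbit m n T0) T"
  shows "triples_dense m n (orbit m n T0)"
  unfolding triples_dense_def using orbit_triples assms adherent_iff_close[OF _ orbit_triples] by blast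

text \<open>A rigid triple has a ball inside its own orbit; this ball meets the dense orbit of
  \<open>T0\<close>, so the two orbits agree. Conversely, openness of the orbit is rigidity of its
  points.\<close>

lemma orbit_eq_rigid:
  assumes T0: "is_triple m n T0" and op: "triples_open m n (orbit m n T0)"
    and de: "triples_dense m n (orbit m n T0)"
  shows "orbit m n T0 = {T. rigid m n T}"
proof (intro equalityI subsetI)
  fix T assume T: "T \<in> orbit m n T0"
  then have Tt: "is_triple m n T" "feedback_similar m n T T0" using T0 feedback_sym unfolding orbit_def by auto
  obtain e where e: "e > 0" "\<And>T'. is_triple m n T' \<Longrightarrow> triple_close e T T' \<Longrightarrow> T' \<in> orbit m n T0"
    using op T unfolding triples_open_def by blast
  have "feedback_similar m n T T'" if "is_triple m n T'" "triple_close e T T'" for T'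
    using e(2)[OF that] feedback_trans[OF Tt] unfolding orbit_def by blast
  then show "T \<in> {T. rigid m n T}" unfolding rigid_def using Tt e(1) by blast
next
  fix T assume "T \<in> {T. rigid m n T}"
  then obtain e where Tt: "is_triple m n T" and e: "e > 0"
    "\<And>T'. is_triple m n T' \<Longrightarrow> triple_close e T T' \<Longrightarrow> feedback_similar m n T T'"
    unfolding rigid_def by blast
  obtain T' where T': "T' \<in> orbit m n T0" "triple_close e T T'"
    using de Tt e(1) unfolding triples_dense_def by blast
  then have "feedback_similar m n T' T" using e(2) Tt feedback_sym unfolding orbit_def by blast
  with T'(1) show "T \<in> orbit m n T0" by (rule orbit_similar[OF T0])
qed

theorem theorem11:
  fixes m n :: nat
  assumes "0 < m" and "0 < n"
  shows "(real m < real n * (1 + sqrt 5) / 2 \<longrightarrow>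
            (\<exists>!T. is_triple m n T \<and> canonical_form T) \<and>
            (\<forall>T. is_triple m n T \<and> canonical_form T \<longrightarrow>
               (let X = {T'. is_triple m n T' \<and> feedback_similar m n T T'} in
                  triples_open m n X \<and> triples_dense m n X \<and>
                  X = {T'. rigid m n T'})))
       \<and> (real m > real n * (1 + sqrt 5) / 2 \<longrightarrow> \<not> (\<exists>T. rigid m n T))"
proof (intro conjI impI)
  assume "real m < real n * (1 + sqrt 5) / 2"
  then have "m * m < m * n + n * n" using golden_ratio_sign(1)[OF assms] by simp
  from canonical_form_open_dense[OF assms(1) this] obtain T0 where T0: "is_triple m n T0" "canonical_form T0"
    "\<And>T. is_triple m n T \<Longrightarrow> canonical_form T \<Longrightarrow> T = T0"
    "interior_point m n (orbit m n T0) T0" "\<And>T. is_triple m n T \<Longrightarrow> adherent m n (orbit m n T0) T"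
    by blast
  show "\<exists>!T. is_triple m n T \<and> canonical_form T"
    by (rule ex1I[of _ T0]) (simp_all add: T0(1-3))
  note op = triples_open_orbit[OF T0(1,4)] and de = triples_dense_orbit[OF T0(5)]
  have "triples_open m n (orbit m n T) \<and> triples_dense m n (orbit m n T) \<and> orbit m n T = {T'. rigid m n T'}"
    if "is_triple m n T" "canonical_form T" for T
    using T0(3)[OF that] op de orbit_eq_rigid[OF T0(1) op de] by simp
  then show "\<forall>T. is_triple m n T \<and> canonical_form T \<longrightarrow>
               (let X = {T'. is_triple m n T' \<and> feedback_similar m n T T'} in
                  triples_open m n X \<and> triples_dense m n X \<and>
                  X = {T'. rigid m n T'})"
    unfolding Let_def orbit_def by blast
next
  assume "real m > real n * (1 + sqrt 5) / 2"
  then show "\<not> (\<exists>T. rigid m n T)" using not_rigid golden_ratio_sign(2)[OF assms] by blast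
qed

end
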